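(* Let $\Lambda=\{\lambda_k\}_{k\ge 0}$ be a non-decreasing sequence of positive numbers tending to $\infty$, let $r\ge 2$ be an integer and let $1\le p<\infty$. Then the set $S^p(\Lambda^r)$ of functions, endowed with the norm $$\|f\|_{S^p(\Lambda^r)}=\sup_{n\ge0}\left\|\frac1{\lambda_n}\sum_{k=0}^n|\lambda_k s_k(f)-\lambda_{k-r}s_{k-r}(f)|\right\|_p,$$ is a Banach space.
   Context: $L^p$ is the usual Banach space of (classes of a.e. equal) $2\pi$-periodic complex-valued measurable functions with $|f|^p$ integrable over a period, with its usual norm $\|\cdot\|_p$. For $f\in L^p$ with Fourier series $\frac12a_0(f)+\sum_{k\ge1}(a_k(f)\cos kt+b_k(f)\sin kt)$, $s_k(f)$ denotes the $k$th partial sum (so $s_0(f)=\frac12a_0(f)$). Convention: $\lambda_{-1}=\dots=\lambda_{-r}=0$ and $s_{-1}(f)=\dots=s_{-r}(f)=0$. A function $f\in L^p$ belongs to $S^p(\Lambda^r)$ if $$\lim_{n\to\infty}\left\|\frac1{\lambda_n}\sum_{k=0}^n|\lambda_k(s_k(f)-f)-\lambda_{k-r}(s_{k-r}(f)-f)|\right\|_p=0.$$ *)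

theory Defs
  imports "HOL-Analysis.Analysis"
begin

definition periodic_measurable :: "(real \<Rightarrow> complex) \<Rightarrow> bool" where
  "periodic_measurable f \<longleftrightarrow>
     f \<in> borel_measurable lebesgue \<and> (\<forall>x. f (x + 2 * pi) = f x)"

definition ae_rel :: "(real \<Rightarrow> complex) \<Rightarrow> (real \<Rightarrow> complex) \<Rightarrow> bool" where
  "ae_rel f g \<longleftrightarrow>
     periodic_measurable f \<and> periodic_measurable g \<and> (AE x in lebesgue. f x = g x)"

quotient_type pfun = "real \<Rightarrow> complex" / partial: ae_rel
proof (rule part_equivpI)
  show "\<exists>f. ae_rel f f"
    by (rule exI[of _ "\<lambda>_. 0"]) (simp add: ae_rel_def periodic_measurable_def)
  show "symp ae_rel"
    by (auto simp: symp_def ae_rel_def)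
  show "transp ae_rel"
    unfolding transp_def ae_rel_def by (auto elim: eventually_elim2)
qed

lemma borel_measurable_lebesgue_trig:
  "(\<lambda>t. complex_of_real (cos (real k * t))) \<in> borel_measurable lebesgue"
  "(\<lambda>t. complex_of_real (sin (real k * t))) \<in> borel_measurable lebesgue"
  by (intro borel_measurable_of_real measurable_completion; measurable)+

lemma borel_measurable_lebesgue_indicator:
  "indicat_real {a..b :: real} \<in> borel_measurable lebesgue"
  by (intro borel_measurable_indicator) simp

lemmas lebesgue_measurable_intros =
  borel_measurable_times borel_measurable_scaleR powr_real_measurable borel_measurable_norm
  borel_measurable_const borel_measurable_lebesgue_trig borel_measurable_lebesgue_indicator

instantiation pfun :: ab_group_add
begin

lift_definition zero_pfun :: pfun is "\<lambda>_. 0"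
  by (simp add: ae_rel_def periodic_measurable_def)

lift_definition plus_pfun :: "pfun \<Rightarrow> pfun \<Rightarrow> pfun" is "\<lambda>f g x. f x + g x"
  by (auto simp: ae_rel_def periodic_measurable_def elim: eventually_elim2)

lift_definition uminus_pfun :: "pfun \<Rightarrow> pfun" is "\<lambda>f x. - f x"
  by (auto simp: ae_rel_def periodic_measurable_def)

lift_definition minus_pfun :: "pfun \<Rightarrow> pfun \<Rightarrow> pfun" is "\<lambda>f g x. f x - g x"
  by (auto simp: ae_rel_def periodic_measurable_def elim: eventually_elim2)

instance
  by standard
    (transfer; auto simp: ae_rel_def periodic_measurable_def algebra_simps)+

end

lift_definition scaleC :: "complex \<Rightarrow> pfun \<Rightarrow> pfun"  (infixr "*\<^sub>C" 75)
  is "\<lambda>c f x. c * f x"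
  by (auto simp: ae_rel_def periodic_measurable_def)

lift_definition modulus :: "pfun \<Rightarrow> pfun" is "\<lambda>f x. complex_of_real (cmod (f x))"
  by (auto simp: ae_rel_def periodic_measurable_def)

lemma vector_space_scaleC: "vector_space (*\<^sub>C)"
  by standard
    (transfer; auto simp: ae_rel_def periodic_measurable_def algebra_simps)+

lift_definition Lp_integrable :: "real \<Rightarrow> pfun \<Rightarrow> bool"
  is "\<lambda>p f. set_integrable lebesgue {-pi..pi} (\<lambda>x. cmod (f x) powr p)"
  unfolding set_integrable_def
  by (rule integrable_cong_AE)
     (auto simp: ae_rel_def periodic_measurable_def intro!: lebesgue_measurable_intros)

definition Lp :: "real \<Rightarrow> pfun set" where
  "Lp p = {f. Lp_integrable p f}"

text \<open>Outside \<open>Lp p\<close> this has the junk value 0. All classes whose norm is taken below lie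
  in \<open>Lp p\<close> (for \<open>p \<ge> 1\<close>): they are built from a member of \<open>Lp p\<close> and trigonometric polynomials.\<close>

lift_definition Lp_norm :: "real \<Rightarrow> pfun \<Rightarrow> real"
  is "\<lambda>p f. (LINT x:{-pi..pi}|lebesgue. cmod (f x) powr p) powr (1 / p)"
  unfolding set_lebesgue_integral_def
  by (rule arg_cong[where f = "\<lambda>I. I powr _"], rule integral_cong_AE)
     (auto simp: ae_rel_def periodic_measurable_def intro!: lebesgue_measurable_intros)

lift_definition fourier_a :: "pfun \<Rightarrow> nat \<Rightarrow> complex"
  is "\<lambda>f k. (LINT t:{-pi..pi}|lebesgue. f t * complex_of_real (cos (real k * t))) / pi"
  unfolding set_lebesgue_integral_def
  by (intro ext arg_cong[where f = "\<lambda>I. I / _"] integral_cong_AE)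
     (auto simp: ae_rel_def periodic_measurable_def intro!: lebesgue_measurable_intros)

lift_definition fourier_b :: "pfun \<Rightarrow> nat \<Rightarrow> complex"
  is "\<lambda>f k. (LINT t:{-pi..pi}|lebesgue. f t * complex_of_real (sin (real k * t))) / pi"
  unfolding set_lebesgue_integral_def
  by (intro ext arg_cong[where f = "\<lambda>I. I / _"] integral_cong_AE)
     (auto simp: ae_rel_def periodic_measurable_def intro!: lebesgue_measurable_intros)

lift_definition trig_poly :: "(nat \<Rightarrow> complex) \<Rightarrow> (nat \<Rightarrow> complex) \<Rightarrow> nat \<Rightarrow> pfun"
  is "\<lambda>a b n t. a 0 / 2 +
        (\<Sum>k=1..n. a k * complex_of_real (cos (real k * t)) + b k * complex_of_real (sin (real k * t)))"
proof -
  fix a b :: "nat \<Rightarrow> complex" and n :: nat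
  have per: "cos (real k * (t + 2 * pi)) = cos (real k * t)"
    "sin (real k * (t + 2 * pi)) = sin (real k * t)" for k t
    using cos.plus_of_nat[of "real k * t" k] sin.plus_of_nat[of "real k * t" k]
    by (simp_all add: algebra_simps)
  show "ae_rel
     (\<lambda>t. a 0 / 2 + (\<Sum>k=1..n. a k * complex_of_real (cos (real k * t)) + b k * complex_of_real (sin (real k * t))))
     (\<lambda>t. a 0 / 2 + (\<Sum>k=1..n. a k * complex_of_real (cos (real k * t)) + b k * complex_of_real (sin (real k * t))))"
    unfolding ae_rel_def periodic_measurable_def per
    by (auto intro!: borel_measurable_add borel_measurable_sum borel_measurable_times
        borel_measurable_lebesgue_trig)
qed

definition partial_sum :: "nat \<Rightarrow> pfun \<Rightarrow> pfun" where
  "partial_sum n f = trig_poly (fourier_a f) (fourier_b f) n"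

text \<open>\<open>lag r a k\<close> is \<open>a\<^bsub>k-r\<^esub>\<close>, where terms of negative index vanish.\<close>

definition lag :: "nat \<Rightarrow> (nat \<Rightarrow> 'a::zero) \<Rightarrow> nat \<Rightarrow> 'a" where
  "lag r a k = (if k < r then 0 else a (k - r))"

definition dev_mean :: "(nat \<Rightarrow> real) \<Rightarrow> nat \<Rightarrow> pfun \<Rightarrow> nat \<Rightarrow> pfun" where
  "dev_mean \<Lambda> r f n =
     complex_of_real (1 / \<Lambda> n) *\<^sub>C
       (\<Sum>k=0..n. modulus (complex_of_real (\<Lambda> k) *\<^sub>C (partial_sum k f - f)
          - complex_of_real (lag r \<Lambda> k) *\<^sub>C (lag r (\<lambda>j. partial_sum j f) k - f)))"

definition sum_mean :: "(nat \<Rightarrow> real) \<Rightarrow> nat \<Rightarrow> pfun \<Rightarrow> nat \<Rightarrow> pfun" where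
  "sum_mean \<Lambda> r f n =
     complex_of_real (1 / \<Lambda> n) *\<^sub>C
       (\<Sum>k=0..n. modulus (complex_of_real (\<Lambda> k) *\<^sub>C partial_sum k f
          - complex_of_real (lag r \<Lambda> k) *\<^sub>C lag r (\<lambda>j. partial_sum j f) k))"

definition Sp :: "real \<Rightarrow> (nat \<Rightarrow> real) \<Rightarrow> nat \<Rightarrow> pfun set" where
  "Sp p \<Lambda> r = {f \<in> Lp p. (\<lambda>n. Lp_norm p (dev_mean \<Lambda> r f n)) \<longlonglongrightarrow> 0}"

text \<open>A real supremum is meaningful only for a bounded family; boundedness has to be
  asserted separately.\<close>

definition Sp_norm :: "real \<Rightarrow> (nat \<Rightarrow> real) \<Rightarrow> nat \<Rightarrow> pfun \<Rightarrow> real" where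
  "Sp_norm p \<Lambda> r f = (SUP n. Lp_norm p (sum_mean \<Lambda> r f n))"

definition complex_banach_space_on ::
  "(complex \<Rightarrow> 'a::ab_group_add \<Rightarrow> 'a) \<Rightarrow> 'a set \<Rightarrow> ('a \<Rightarrow> real) \<Rightarrow> bool" where
  "complex_banach_space_on smul V N \<longleftrightarrow>
     vector_space smul \<and> module.subspace smul V \<and>
     (\<forall>x\<in>V. 0 \<le> N x \<and> (N x = 0 \<longleftrightarrow> x = 0)) \<and>
     (\<forall>x\<in>V. \<forall>y\<in>V. N (x + y) \<le> N x + N y) \<and>
     (\<forall>c. \<forall>x\<in>V. N (smul c x) = cmod c * N x) \<and>
     (\<forall>\<sigma>. range \<sigma> \<subseteq> V \<longrightarrow>
          (\<forall>e>0. \<exists>M. \<forall>m\<ge>M. \<forall>n\<ge>M. N (\<sigma> m - \<sigma> n) < e) \<longrightarrow>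
          (\<exists>x\<in>V. (\<lambda>n::nat. N (\<sigma> n - x)) \<longlonglongrightarrow> 0))"

end

(*
  Write Q_n(u) for the norm of (1/\<Lambda>_n) \<Sum>_{k\<le>n} |u_k|, which is a seminorm in the sequence u. Summing the differences
  \<Lambda>_k s_k - \<Lambda>_{k-r} s_{k-r} over k = n, n-r, n-2r, ... gives \<Lambda>_n s_n, whence \<parallel>s_n f\<parallel> is at most the
  n-th term of the supremum defining the norm N f, and likewise \<parallel>s_n f - f\<parallel> is at most the n-th deviation.
  So \<parallel>f\<parallel>_p \<le> N f on S^p, which yields definiteness and sends N-Cauchy sequences to L^p-Cauchy ones.
  In the other direction \<Sum>_{k\<le>n} (\<Lambda>_k - \<Lambda>_{k-r}) \<le> r \<Lambda>_n, so the n-th term of the supremum and the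
  n-th deviation differ by at most r \<parallel>f\<parallel>_p. Hence N is finite, and the L^p limit of an N-Cauchy sequence
  is also its N-limit and stays in S^p, each s_k being continuous on L^p.
*)

theory Submission
  imports Defs
begin

subsection \<open>\<open>L\<^sup>p\<close> seminorms on a measure space\<close>

text \<open>Measurability is demanded separately because integrability of the power of the norm does
  not imply it.\<close>

definition Lp_fun :: "'a measure \<Rightarrow> real \<Rightarrow> ('a \<Rightarrow> 'b::{banach, second_countable_topology}) \<Rightarrow> bool" where
  "Lp_fun M p f \<longleftrightarrow> f \<in> borel_measurable M \<and> integrable M (\<lambda>x. norm (f x) powr p)"

definition Lp_seminorm :: "'a measure \<Rightarrow> real \<Rightarrow> ('a \<Rightarrow> 'b::{banach, second_countable_topology}) \<Rightarrow> real" where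
  "Lp_seminorm M p f = (LINT x|M. norm (f x) powr p) powr (1 / p)"

lemma Lp_seminorm_nonneg: "0 \<le> Lp_seminorm M p f"
  by (simp add: Lp_seminorm_def)

text \<open>Raising to the power \<open>p\<close> is strictly increasing on non-negative reals. This
  turns norm bounds into integral bounds free of the outer root.\<close>

lemma Lp_seminorm_le_iff:
  assumes "1 \<le> p" "0 \<le> t"
  shows "Lp_seminorm M p f \<le> t \<longleftrightarrow> (LINT x|M. norm (f x) powr p) \<le> t powr p"
proof -
  have nn: "0 \<le> (LINT x|M. norm (f x) powr p)"
    by (rule integral_nonneg_AE) simp
  have "Lp_seminorm M p f powr p = (LINT x|M. norm (f x) powr p)"
    using assms nn by (simp add: Lp_seminorm_def powr_powr)
  then show ?thesis
    using assms powr_mono2[of p "Lp_seminorm M p f" t] powr_less_mono2[of p t "Lp_seminorm M p f"]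
      Lp_seminorm_nonneg[of M p f]
    by (metis less_eq_real_def not_less zero_less_one order_less_le_trans)
qed

section \<open>Convexity of powers and Minkowski's inequality\<close>

lemma powr_convex_combination:
  fixes u v t p :: real
  assumes "1 \<le> p" "0 \<le> u" "0 \<le> v" "0 \<le> t" "t \<le> 1"
  shows "((1 - t) * u + t * v) powr p \<le> (1 - t) * u powr p + t * v powr p"
proof -
  \<comment> \<open>Settles the boundary cases \<open>u = 0\<close> and \<open>v = 0\<close>, since
    \<open>s powr p\<close> is at most \<open>s\<close> on the unit interval. Convexity handles the
    interior.\<close>
  have contract: "(s * w) powr p \<le> s * w powr p" if "0 \<le> s" "s \<le> 1" "0 \<le> w" for s w :: real
  proof -
    have "s powr p \<le> s"
      using that assms powr_mono'[of 1 p s] by (cases "s = 0") auto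
    then show ?thesis
      using that by (simp add: powr_mult mult_right_mono)
  qed
  consider "u = 0" | "v = 0" | "0 < u" "0 < v"
    using assms by linarith
  then show ?thesis
  proof cases
    case 3
    then show ?thesis
      using convex_onD[OF powr_convex[OF assms(1)], of t u v] assms by simp
  qed (use assms contract[of t v] contract[of "1 - t" u] in auto)
qed

text \<open>The sum of the norms is \<open>a + b\<close> times the convex combination of
  \<open>norm x / a\<close> and \<open>norm y / b\<close> with weights proportional to
  \<open>a\<close> and \<open>b\<close>. Integrated with \<open>a\<close> and \<open>b\<close> just
  above the seminorms of two functions, this is Minkowski's inequality.\<close>

lemma powr_norm_add_le:
  fixes x y :: "'b::real_normed_vector"
  assumes "1 \<le> p" "0 < a" "0 < b"
  shows "norm (x + y) powr p \<le>
    (a + b) powr p * (a / (a + b) * (norm x powr p / a powr p) + b / (a + b) * (norm y powr p / b powr p))"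
proof -
  define t where "t = b / (a + b)"
  have t: "0 \<le> t" "t \<le> 1" "1 - t = a / (a + b)"
    using assms by (auto simp: t_def field_simps)
  have "norm x + norm y = (a + b) * ((1 - t) * (norm x / a) + t * (norm y / b))"
    using assms unfolding t(3) by (simp add: t_def distrib_left)
  then have "norm (x + y) powr p \<le> ((a + b) * ((1 - t) * (norm x / a) + t * (norm y / b))) powr p"
    using assms norm_triangle_ineq[of x y] by (metis norm_ge_zero order_trans powr_mono2 zero_le_one)
  also have "\<dots> = (a + b) powr p * ((1 - t) * (norm x / a) + t * (norm y / b)) powr p"
    by (rule powr_mult)
  also have "\<dots> \<le> (a + b) powr p * ((1 - t) * (norm x / a) powr p + t * (norm y / b) powr p)"
    using assms t by (intro mult_left_mono powr_convex_combination) auto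
  also have "\<dots> = (a + b) powr p *
      (a / (a + b) * (norm x / a) powr p + b / (a + b) * (norm y / b) powr p)"
    unfolding t(3) by (simp add: t_def)
  finally show ?thesis
    using assms by (simp add: powr_divide)
qed

lemma Lp_fun_add:
  assumes "1 \<le> p" "Lp_fun M p f" "Lp_fun M p g"
  shows "Lp_fun M p (\<lambda>x. f x + g x)"
  unfolding Lp_fun_def
proof
  show meas: "(\<lambda>x. f x + g x) \<in> borel_measurable M"
    using assms unfolding Lp_fun_def by (intro borel_measurable_add) auto
  show "integrable M (\<lambda>x. norm (f x + g x) powr p)"
  proof (rule Bochner_Integration.integrable_bound)
    \<comment> \<open>The dominating function is the pointwise bound with
      \<open>a = b = 1\<close>.\<close>
    show "integrable M (\<lambda>x. 2 powr p * (1 / 2 * norm (f x) powr p + 1 / 2 * norm (g x) powr p))"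
      using assms by (simp add: Lp_fun_def)
    show "(\<lambda>x. norm (f x + g x) powr p) \<in> borel_measurable M"
      using meas by measurable
    show "AE x in M. norm (norm (f x + g x) powr p)
        \<le> norm (2 powr p * (1 / 2 * norm (f x) powr p + 1 / 2 * norm (g x) powr p))"
    proof (rule AE_I2)
      fix x
      show "norm (norm (f x + g x) powr p)
        \<le> norm (2 powr p * (1 / 2 * norm (f x) powr p + 1 / 2 * norm (g x) powr p))"
        using powr_norm_add_le[OF assms(1), of 1 1 "f x" "g x"]
        by (simp add: abs_mult)
    qed
  qed
qed

lemma Lp_seminorm_add:
  assumes "1 \<le> p" "Lp_fun M p f" "Lp_fun M p g"
  shows "Lp_seminorm M p (\<lambda>x. f x + g x) \<le> Lp_seminorm M p f + Lp_seminorm M p g"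
proof (rule field_le_epsilon)
  fix e :: real
  assume "0 < e"
  \<comment> \<open>The slack \<open>e / 2\<close> keeps \<open>a\<close> and \<open>b\<close>
    positive, so that dividing by them is possible even when a seminorm vanishes.\<close>
  define a where "a = Lp_seminorm M p f + e / 2"
  define b where "b = Lp_seminorm M p g + e / 2"
  have ab: "0 < a" "0 < b" "Lp_seminorm M p f \<le> a" "Lp_seminorm M p g \<le> b"
    using Lp_seminorm_nonneg[of M p f] Lp_seminorm_nonneg[of M p g] \<open>0 < e\<close> by (auto simp: a_def b_def)
  have f: "(LINT x|M. norm (f x) powr p) / a powr p \<le> 1"
    and g: "(LINT x|M. norm (g x) powr p) / b powr p \<le> 1"
    using ab Lp_seminorm_le_iff[OF assms(1), of a M f] Lp_seminorm_le_iff[OF assms(1), of b M g] by auto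
  have intf: "integrable M (\<lambda>x. norm (f x) powr p)" and intg: "integrable M (\<lambda>x. norm (g x) powr p)"
    and intfg: "integrable M (\<lambda>x. norm (f x + g x) powr p)"
    using assms Lp_fun_add[OF assms] by (auto simp: Lp_fun_def)
  have "(LINT x|M. norm (f x + g x) powr p) \<le>
    (LINT x|M. (a + b) powr p *
      (a / (a + b) * (norm (f x) powr p / a powr p) + b / (a + b) * (norm (g x) powr p / b powr p)))"
    using intf intg intfg powr_norm_add_le[OF assms(1) ab(1,2)] by (intro integral_mono) auto
  also have "\<dots> = (a + b) powr p * (a / (a + b) * ((LINT x|M. norm (f x) powr p) / a powr p)
      + b / (a + b) * ((LINT x|M. norm (g x) powr p) / b powr p))"
    using intf intg by simp
  \<comment> \<open>By the choice of \<open>a\<close> and \<open>b\<close> both normalised integrals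
    are at most 1, and the two weights add up to 1.\<close>
  also have "\<dots> \<le> (a + b) powr p * (a / (a + b) * 1 + b / (a + b) * 1)"
    using ab f g by (intro mult_left_mono add_mono) auto
  also have "\<dots> = (a + b) powr p"
    using ab by (simp flip: add_divide_distrib)
  finally show "Lp_seminorm M p (\<lambda>x. f x + g x) \<le> Lp_seminorm M p f + Lp_seminorm M p g + e"
    using ab Lp_seminorm_le_iff[OF assms(1), of "a + b" M "\<lambda>x. f x + g x"] by (simp add: a_def b_def)
qed

section \<open>Comparison with the L^1 norm on a finite measure space\<close>

lemma norm_le_powr:
  fixes s t p :: real
  assumes "1 \<le> p" "0 < t" "0 \<le> s"
  shows "s \<le> t + t powr (1 - p) * s powr p"
proof (cases "s \<le> t")
  case False
  then have "s = s powr (1 - p) * s powr p"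
    using assms by (simp flip: powr_add)
  \<comment> \<open>The exponent \<open>1 - p\<close> is at most 0, so this power decreases in its
    base.\<close>
  also have "\<dots> \<le> t powr (1 - p) * s powr p"
    using False assms powr_mono2'[of "1 - p" t s] by (intro mult_right_mono) auto
  finally show ?thesis
    using assms by simp
qed (use assms in \<open>simp add: add_increasing2\<close>)

lemma Lp_fun_integrable:
  assumes "finite_measure M" "1 \<le> p" "Lp_fun M p f"
  shows "integrable M f"
proof (rule Bochner_Integration.integrable_bound)
  interpret finite_measure M by fact
  show "integrable M (\<lambda>x. 1 + 1 powr (1 - p) * norm (f x) powr p)"
    using assms by (simp add: Lp_fun_def)
  show "f \<in> borel_measurable M"
    using assms by (simp add: Lp_fun_def)
  show "AE x in M. norm (f x) \<le> norm (1 + 1 powr (1 - p) * norm (f x) powr p)"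
    using norm_le_powr[OF assms(2), of 1] by (intro AE_I2) auto
qed

text \<open>Integrating \<open>norm_le_powr\<close> with \<open>t\<close> close to the seminorm
  bounds both resulting terms by multiples of \<open>t\<close>, with factors
  \<open>measure M (space M)\<close> and 1. The constant is cruder than the one from Hoelder's
  inequality.\<close>

lemma L1_le_Lp_seminorm:
  assumes "finite_measure M" "1 \<le> p" "Lp_fun M p f"
  shows "(LINT x|M. norm (f x)) \<le> (measure M (space M) + 1) * Lp_seminorm M p f"
proof (rule field_le_epsilon)
  interpret finite_measure M by fact
  let ?C = "measure M (space M) + 1"
  fix e :: real
  assume "0 < e"
  have C: "0 < ?C"
    using measure_nonneg[of M "space M"] by linarith
  \<comment> \<open>The added term makes \<open>t\<close> positive and contributes exactly
    \<open>e\<close> after multiplication by \<open>?C\<close>.\<close>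
  define t where "t = Lp_seminorm M p f + e / ?C"
  have t: "0 < t" "Lp_seminorm M p f \<le> t"
    using \<open>0 < e\<close> C Lp_seminorm_nonneg[of M p f]
    by (auto simp: t_def intro!: add_nonneg_pos divide_pos_pos)
  have int: "integrable M (\<lambda>x. norm (f x) powr p)"
    using assms by (simp add: Lp_fun_def)
  have "(LINT x|M. norm (f x)) \<le> (LINT x|M. t + t powr (1 - p) * norm (f x) powr p)"
    using Lp_fun_integrable[OF assms] int norm_le_powr[OF assms(2) t(1)] by (intro integral_mono) auto
  also have "\<dots> = measure M (space M) * t + t powr (1 - p) * (LINT x|M. norm (f x) powr p)"
    using int by simp
  also have "\<dots> \<le> measure M (space M) * t + t powr (1 - p) * t powr p"
    using t Lp_seminorm_le_iff[OF assms(2), of t M f] by (intro add_left_mono mult_left_mono) auto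
  also have "\<dots> = ?C * t"
    using t by (simp add: algebra_simps flip: powr_add)
  also have "\<dots> = ?C * Lp_seminorm M p f + e"
    using C by (simp add: t_def distrib_left)
  finally show "(LINT x|M. norm (f x)) \<le> ?C * Lp_seminorm M p f + e" .
qed

section \<open>Almost everywhere limits and completeness\<close>

lemma Lp_fun_Fatou:
  assumes p: "1 \<le> p" and t: "0 \<le> t"
    and fn: "\<And>n. Lp_fun M p (f n)" and le: "\<And>n. Lp_seminorm M p (f n) \<le> t"
    and lim: "AE x in M. (\<lambda>n. f n x) \<longlonglongrightarrow> g x" and g: "g \<in> borel_measurable M"
  shows "Lp_fun M p g" "Lp_seminorm M p g \<le> t"
proof -
  have gp: "(\<lambda>x. norm (g x) powr p) \<in> borel_measurable M"
    using g by measurable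
  have "(\<integral>\<^sup>+ x. ennreal (norm (g x) powr p) \<partial>M)
      = (\<integral>\<^sup>+ x. liminf (\<lambda>n. ennreal (norm (f n x) powr p)) \<partial>M)"
  proof (rule nn_integral_cong_AE, use lim in eventually_elim)
    fix x assume "(\<lambda>n. f n x) \<longlonglongrightarrow> g x"
    then have "(\<lambda>n. ennreal (norm (f n x) powr p)) \<longlonglongrightarrow> ennreal (norm (g x) powr p)"
      using p by (intro tendsto_ennrealI tendsto_powr' tendsto_norm tendsto_const) auto
    then show "ennreal (norm (g x) powr p) = liminf (\<lambda>n. ennreal (norm (f n x) powr p))"
      by (metis lim_imp_Liminf sequentially_bot)
  qed
  \<comment> \<open>Fatou's lemma for the powers of the norms.\<close>
  also have "\<dots> \<le> liminf (\<lambda>n. \<integral>\<^sup>+ x. ennreal (norm (f n x) powr p) \<partial>M)"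
    using fn by (intro nn_integral_liminf) (auto simp: Lp_fun_def)
  also have "\<dots> \<le> ennreal (t powr p)"
  proof -
    have "(\<integral>\<^sup>+ x. ennreal (norm (f n x) powr p) \<partial>M) \<le> ennreal (t powr p)" for n
    proof -
      have "(\<integral>\<^sup>+ x. ennreal (norm (f n x) powr p) \<partial>M) = ennreal (LINT x|M. norm (f n x) powr p)"
        using fn[of n] by (intro nn_integral_eq_integral) (auto simp: Lp_fun_def)
      also have "\<dots> \<le> ennreal (t powr p)"
        using le[of n] Lp_seminorm_le_iff[OF p t, of M "f n"] by (intro ennreal_leI) simp
      finally show ?thesis .
    qed
    then show ?thesis
      by (intro Liminf_le) auto
  qed
  finally have bound: "(\<integral>\<^sup>+ x. ennreal (norm (g x) powr p) \<partial>M) \<le> ennreal (t powr p)" .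
  then have int: "integrable M (\<lambda>x. norm (g x) powr p)"
    using gp by (intro integrableI_nonneg) (auto simp: top.extremum_strict le_less_trans)
  then show "Lp_fun M p g"
    using g by (simp add: Lp_fun_def)
  have "ennreal (LINT x|M. norm (g x) powr p) \<le> ennreal (t powr p)"
    using bound int by (subst (asm) nn_integral_eq_integral) auto
  then show "Lp_seminorm M p g \<le> t"
    using Lp_seminorm_le_iff[OF p t, of M g] by simp
qed

text \<open>The limit is given as a pointwise limit of representatives, so that it inherits their periodicity.\<close>

lemma Lp_complete:
  fixes s :: "nat \<Rightarrow> 'a \<Rightarrow> 'b::{banach, second_countable_topology}"
  assumes fin: "finite_measure M" and p: "1 \<le> p" and s: "\<And>n. Lp_fun M p (s n)"
    and Cauchy: "\<And>e. 0 < e \<Longrightarrow> \<exists>N. \<forall>m\<ge>N. \<forall>n\<ge>N. Lp_seminorm M p (\<lambda>x. s m x - s n x) < e"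
  obtains \<phi> where "strict_mono \<phi>"
    and "Lp_fun M p (\<lambda>x. lim (\<lambda>i. s (\<phi> i) x))"
    and "(\<lambda>n. Lp_seminorm M p (\<lambda>x. s n x - lim (\<lambda>i. s (\<phi> i) x))) \<longlonglongrightarrow> 0"
proof -
  have neg: "Lp_fun M p (\<lambda>x. - s n x)" for n
    using s[of n] by (auto simp: Lp_fun_def)
  have diff: "Lp_fun M p (\<lambda>x. s m x - s n x)" for m n
    using Lp_fun_add[OF p s[of m] neg[of n]] by simp
  define C where "C = measure M (space M) + 1"
  have C: "0 < C"
    using measure_nonneg[of M "space M"] unfolding C_def by linarith
  \<comment> \<open>The sequence is Cauchy in L^1 as well, which provides a subsequence that is
    Cauchy almost everywhere.\<close>
  have "\<exists>N. \<forall>i\<ge>N. \<forall>j\<ge>N. (LINT x|M. norm (s i x - s j x)) < e" if "0 < e" for e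
  proof -
    obtain N where N: "\<And>i j. N \<le> i \<Longrightarrow> N \<le> j \<Longrightarrow> Lp_seminorm M p (\<lambda>x. s i x - s j x) < e / C"
      using Cauchy C \<open>0 < e\<close> by (metis divide_pos_pos)
    have "(LINT x|M. norm (s i x - s j x)) < e" if "N \<le> i" "N \<le> j" for i j
    proof -
      have "(LINT x|M. norm (s i x - s j x)) \<le> C * Lp_seminorm M p (\<lambda>x. s i x - s j x)"
        unfolding C_def by (rule L1_le_Lp_seminorm[OF fin p diff])
      also have "\<dots> < e"
        using N[OF that] C by (simp add: field_simps)
      finally show ?thesis .
    qed
    then show ?thesis by blast
  qed
  then obtain \<phi> where \<phi>: "strict_mono \<phi>" "AE x in M. Cauchy (\<lambda>i. s (\<phi> i) x)"
    using cauchy_L1_AE_cauchy_subseq[of M s] Lp_fun_integrable[OF fin p s] by metis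
  define g where "g x = lim (\<lambda>i. s (\<phi> i) x)" for x
  have g: "g \<in> borel_measurable M"
    unfolding g_def using s by (intro borel_measurable_lim_metric) (simp add: Lp_fun_def)
  have lim: "AE x in M. (\<lambda>i. s (\<phi> i) x) \<longlonglongrightarrow> g x"
    using \<phi>(2) unfolding g_def by (auto simp: Cauchy_convergent_iff convergent_LIMSEQ_iff)
  have *: "Lp_fun M p (\<lambda>x. s n x - g x)" "Lp_seminorm M p (\<lambda>x. s n x - g x) \<le> e"
    if "0 < e" and N: "\<And>i j. N \<le> i \<Longrightarrow> N \<le> j \<Longrightarrow> Lp_seminorm M p (\<lambda>x. s i x - s j x) < e" and n: "N \<le> n"
    for e N n
  proof -
    \<comment> \<open>With \<open>n\<close> fixed, Fatou is applied along the subsequence. The shift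
      by \<open>N\<close> puts every index \<open>\<phi> (i + N)\<close> in the range of the Cauchy
      bound.\<close>
    have lim': "AE x in M. (\<lambda>i. s n x - s (\<phi> (i + N)) x) \<longlonglongrightarrow> s n x - g x"
      using lim by eventually_elim
        (intro tendsto_diff tendsto_const, rule LIMSEQ_ignore_initial_segment)
    have le: "Lp_seminorm M p (\<lambda>x. s n x - s (\<phi> (i + N)) x) \<le> e" for i
      using N[OF n, of "\<phi> (i + N)"] seq_suble[OF \<phi>(1), of "i + N"] by simp
    have meas: "(\<lambda>x. s n x - g x) \<in> borel_measurable M"
      using s[of n] g by (auto simp: Lp_fun_def intro: borel_measurable_diff)
    show "Lp_fun M p (\<lambda>x. s n x - g x)" "Lp_seminorm M p (\<lambda>x. s n x - g x) \<le> e"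
      using Lp_fun_Fatou[OF p _ diff le lim' meas] \<open>0 < e\<close> by auto
  qed
  show ?thesis
  proof (rule that[OF \<phi>(1)])
    obtain N where N: "\<And>i j. N \<le> i \<Longrightarrow> N \<le> j \<Longrightarrow> Lp_seminorm M p (\<lambda>x. s i x - s j x) < 1"
      using Cauchy[of 1] by auto
    \<comment> \<open>One difference in L^p suffices: \<open>g\<close> is the sum of
      \<open>g - s N\<close> and \<open>s N\<close>.\<close>
    have "Lp_fun M p (\<lambda>x. s N x - g x)"
      using *(1)[of 1 N N] N by auto
    then have "Lp_fun M p (\<lambda>x. g x - s N x)"
      unfolding Lp_fun_def by (auto simp: norm_minus_commute dest: borel_measurable_uminus)
    from Lp_fun_add[OF p this s[of N]]
    show "Lp_fun M p (\<lambda>x. lim (\<lambda>i. s (\<phi> i) x))"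
      by (simp add: g_def)
    show "(\<lambda>n. Lp_seminorm M p (\<lambda>x. s n x - lim (\<lambda>i. s (\<phi> i) x))) \<longlonglongrightarrow> 0"
      unfolding g_def[symmetric]
    proof (rule LIMSEQ_I)
      fix e :: real assume "0 < e"
      then obtain N where N: "\<And>i j. N \<le> i \<Longrightarrow> N \<le> j \<Longrightarrow> Lp_seminorm M p (\<lambda>x. s i x - s j x) < e / 2"
        using Cauchy[of "e / 2"] by auto
      have "Lp_seminorm M p (\<lambda>x. s n x - g x) < e" if "N \<le> n" for n
        using *(2)[OF _ N that] \<open>0 < e\<close> by simp
      then show "\<exists>N. \<forall>n\<ge>N. norm (Lp_seminorm M p (\<lambda>x. s n x - g x) - 0) < e"
        by (auto simp: abs_of_nonneg[OF Lp_seminorm_nonneg])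
    qed
  qed
qed

interpretation pfun: vector_space "(*\<^sub>C)"
  by (rule vector_space_scaleC)

subsection \<open>The space \<open>Lp\<close> of periodic functions\<close>

abbreviation circle :: "real measure" where
  "circle \<equiv> lebesgue_on {-pi..pi}"

lemma finite_measure_circle: "finite_measure circle"
  by (rule finite_measure_lebesgue_on) simp

lemma periodic_measurable_circle: "periodic_measurable f \<Longrightarrow> f \<in> borel_measurable circle"
  unfolding periodic_measurable_def by (auto intro: measurable_restrict_space1)

lemma AE_circle: "AE x in lebesgue. P x \<Longrightarrow> AE x in circle. P x"
  by (subst AE_restrict_space_iff) (auto elim: eventually_mono)

lemma integrable_circle_iff:
  fixes f :: "real \<Rightarrow> 'b::{banach, second_countable_topology}"
  shows "set_integrable lebesgue {-pi..pi} f \<longleftrightarrow> integrable circle f"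
  by (simp add: set_integrable_def integrable_restrict_space)

lemma integral_circle:
  fixes f :: "real \<Rightarrow> 'b::{banach, second_countable_topology}"
  shows "(LINT x:{-pi..pi}|lebesgue. f x) = (LINT x|circle. f x)"
  by (simp add: set_lebesgue_integral_def integral_restrict_space)

lemma Lp_integrable_circle_iff:
  assumes "periodic_measurable f"
  shows "set_integrable lebesgue {-pi..pi} (\<lambda>x. cmod (f x) powr p) \<longleftrightarrow> Lp_fun circle p f"
  using periodic_measurable_circle[OF assms] by (simp add: integrable_circle_iff Lp_fun_def)

lemma Lp_norm_circle:
  "(LINT x:{-pi..pi}|lebesgue. cmod (f x) powr p) powr (1 / p) = Lp_seminorm circle p f"
  by (simp add: integral_circle Lp_seminorm_def)

text \<open>The exceptional set is covered by countably many translates of its part in one period.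
  This links integrals over one period with classes modulo null sets of the whole line.\<close>

lemma AE_periodic:
  assumes per: "\<And>x::real. P (x + 2 * pi) = P x" and ae: "AE x in circle. P x"
  shows "AE x in lebesgue. P x"
proof -
  define N where "N = {x \<in> {-pi..pi}. \<not> P x}"
  have "AE x in lebesgue. x \<in> {-pi..pi} \<longrightarrow> P x"
    using ae by (subst (asm) AE_restrict_space_iff) auto
  \<comment> \<open>A priori \<open>N\<close> is only contained in a null set; completeness of
    Lebesgue measure makes it a null set itself.\<close>
  then obtain N' where "N' \<in> null_sets lebesgue" "N \<subseteq> N'"
    by (auto elim!: AE_E3 simp: N_def) blast
  then have "N \<in> null_sets lebesgue"
    using negligible_iff_null_sets negligible_subset by blast
  then have N: "negligible N"
    by (simp add: negligible_iff_null_sets)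
  have nat: "P (x + 2 * pi * real n) = P x" for x n
  proof (induction n)
    case (Suc n)
    have "x + 2 * pi * real (Suc n) = (x + 2 * pi * real n) + 2 * pi"
      by (simp add: algebra_simps)
    then show ?case
      using per Suc by metis
  qed simp
  have int: "P (x + 2 * pi * of_int k) = P x" for x k
  proof (cases k)
    case (nonneg n)
    then show ?thesis
      using nat[of x n] by (metis of_int_of_nat_eq)
  next
    case (neg n)
    have "x + 2 * pi * of_int k + 2 * pi * real (Suc n) = x"
      unfolding neg by (simp add: algebra_simps)
    then show ?thesis
      using nat[of "x + 2 * pi * of_int k" "Suc n"] by metis
  qed
  have "{x. \<not> P x} \<subseteq> (\<Union>k::int. (+) (2 * pi * of_int k) ` N)"
  proof
    fix x assume "x \<in> {x. \<not> P x}"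
    \<comment> \<open>The number of periods by which \<open>x\<close> must be moved back to reach
      \<open>{-pi..pi}\<close>.\<close>
    define k where "k = \<lfloor>(x + pi) / (2 * pi)\<rfloor>"
    define y where "y = x - 2 * pi * of_int k"
    have "of_int k \<le> (x + pi) / (2 * pi)" "(x + pi) / (2 * pi) \<le> of_int k + 1"
      unfolding k_def by linarith+
    then have "y \<in> {-pi..pi}"
      by (simp add: y_def field_simps)
    moreover have "\<not> P y"
      using \<open>x \<in> {x. \<not> P x}\<close> int[of y k] by (simp add: y_def)
    ultimately have "x = 2 * pi * of_int k + y" "y \<in> N"
      by (simp_all add: y_def N_def)
    then show "x \<in> (\<Union>k::int. (+) (2 * pi * of_int k) ` N)"
      by blast
  qed
  moreover have "negligible (\<Union>k::int. (+) (2 * pi * of_int k) ` N)"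
    by (intro negligible_countable_Union) (auto intro: negligible_translation N)
  ultimately have "{x. \<not> P x} \<in> null_sets lebesgue"
    using negligible_subset negligible_iff_null_sets by blast
  then show ?thesis
    by (intro AE_I'[of "{x. \<not> P x}"]) auto
qed

text \<open>Comparing with \<open>Re (g x)\<close> rather than \<open>cmod (g x)\<close> makes the relation additive.\<close>

lift_definition majorized :: "pfun \<Rightarrow> pfun \<Rightarrow> bool"  (infix "\<preceq>" 50)
  is "\<lambda>f g. AE x in lebesgue. cmod (f x) \<le> Re (g x)"
  by (auto simp: ae_rel_def elim: eventually_elim2 intro!: eventually_subst)

lemma majorized_modulus: "f \<preceq> modulus f"
  by transfer simp

lemma modulus_majorized: "f \<preceq> g \<Longrightarrow> modulus f \<preceq> g"
  by transfer simp

lemma majorized_zero: "0 \<preceq> 0"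
  by transfer simp

lemma zero_majorized_modulus: "0 \<preceq> modulus f"
  by transfer simp

lemma majorized_add: "f \<preceq> g \<Longrightarrow> f' \<preceq> g' \<Longrightarrow> f + f' \<preceq> g + g'"
  by (transfer, erule (1) eventually_elim2, rule norm_triangle_le) simp

lemma majorized_scaleC:
  "f \<preceq> g \<Longrightarrow> 0 \<le> c \<Longrightarrow> complex_of_real c *\<^sub>C f \<preceq> complex_of_real c *\<^sub>C g"
  by (transfer, erule eventually_mono) (simp add: norm_mult mult_left_mono)

lemma majorized_sum: "(\<And>k. k \<in> I \<Longrightarrow> u k \<preceq> v k) \<Longrightarrow> sum u I \<preceq> sum v I"
  by (induction I rule: infinite_finite_induct) (auto intro: majorized_add majorized_zero)

lemma sum_majorized_sum_modulus:
  assumes "finite J" "I \<subseteq> J"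
  shows "sum u I \<preceq> (\<Sum>k\<in>J. modulus (u k))"
proof -
  \<comment> \<open>Padding with zeros outside \<open>I\<close> lets the extra moduli be compared
    termwise with 0.\<close>
  have "sum u I + (\<Sum>k\<in>J - I. 0) \<preceq> (\<Sum>k\<in>I. modulus (u k)) + (\<Sum>k\<in>J - I. modulus (u k))"
    by (intro majorized_add majorized_sum majorized_modulus zero_majorized_modulus)
  moreover have "(\<Sum>k\<in>J. modulus (u k)) = (\<Sum>k\<in>I. modulus (u k)) + (\<Sum>k\<in>J - I. modulus (u k))"
    using assms by (simp add: sum.subset_diff[of I J] add.commute)
  ultimately show ?thesis
    by simp
qed

lemma modulus_add: "modulus (f + g) \<preceq> modulus f + modulus g"
  by (intro modulus_majorized majorized_add majorized_modulus)

lemma modulus_scaleC: "modulus (c *\<^sub>C f) = complex_of_real (cmod c) *\<^sub>C modulus f"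
  by transfer (auto simp: ae_rel_def periodic_measurable_def norm_mult)

section \<open>Norm properties and completeness of L^p\<close>

context
  fixes p :: real
  assumes p: "1 \<le> p"
begin

text \<open>Since \<open>Re z \<le> cmod z\<close>, majorization bounds the \<open>p\<close>-th
  powers pointwise, and the integral is monotone. Pointwise estimates of classes become norm
  estimates in this way.\<close>

lemma
  assumes "f \<preceq> g" "g \<in> Lp p"
  shows Lp_majorized: "f \<in> Lp p" and Lp_norm_majorized: "Lp_norm p f \<le> Lp_norm p g"
proof -
  have "f \<in> Lp p \<and> Lp_norm p f \<le> Lp_norm p g"
    using assms unfolding Lp_def mem_Collect_eq
  proof (transfer fixing: p)
    fix f g
    assume "ae_rel f f" "ae_rel g g"
      and ae: "AE x in lebesgue. cmod (f x) \<le> Re (g x)"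
      and int: "set_integrable lebesgue {-pi..pi} (\<lambda>x. cmod (g x) powr p)"
    then have per: "periodic_measurable f" "periodic_measurable g"
      by (simp_all add: ae_rel_def)
    note meas = periodic_measurable_circle[OF per(1)] periodic_measurable_circle[OF per(2)]
    have le: "AE x in circle. cmod (f x) powr p \<le> cmod (g x) powr p"
      by (rule AE_circle) (use ae p in \<open>auto elim!: eventually_mono
        intro!: powr_mono2 intro: order_trans[OF _ complex_Re_le_cmod]\<close>)
    have g: "integrable circle (\<lambda>x. cmod (g x) powr p)"
      using int by (simp add: integrable_circle_iff)
    have f: "integrable circle (\<lambda>x. cmod (f x) powr p)"
      by (rule Bochner_Integration.integrable_bound[OF g])
        (use meas(1) le in \<open>auto intro!: powr_real_measurable borel_measurable_norm\<close>)
    have "(LINT x|circle. cmod (f x) powr p) \<le> (LINT x|circle. cmod (g x) powr p)"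
      by (rule integral_mono_AE[OF f g le])
    then have "(LINT x|circle. cmod (f x) powr p) powr (1 / p)
        \<le> (LINT x|circle. cmod (g x) powr p) powr (1 / p)"
      using p by (intro powr_mono2 integral_nonneg_AE) auto
    then show "set_integrable lebesgue {-pi..pi} (\<lambda>x. cmod (f x) powr p) \<and>
       (LINT x:{-pi..pi}|lebesgue. cmod (f x) powr p) powr (1 / p)
        \<le> (LINT x:{-pi..pi}|lebesgue. cmod (g x) powr p) powr (1 / p)"
      using f by (simp add: integrable_circle_iff integral_circle)
  qed
  then show "f \<in> Lp p" "Lp_norm p f \<le> Lp_norm p g" by auto
qed

lemma Lp_norm_nonneg: "0 \<le> Lp_norm p f"
  by (transfer fixing: p) simp

lemma
  shows Lp_modulus: "modulus f \<in> Lp p \<longleftrightarrow> f \<in> Lp p"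
    and Lp_norm_modulus: "Lp_norm p (modulus f) = Lp_norm p f"
  unfolding Lp_def mem_Collect_eq by (transfer fixing: p; simp)+

lemma Lp_scaleC: "f \<in> Lp p \<Longrightarrow> c *\<^sub>C f \<in> Lp p"
  unfolding Lp_def mem_Collect_eq
  by (transfer fixing: p) (simp add: integrable_circle_iff norm_mult powr_mult)

lemma Lp_norm_scaleC: "Lp_norm p (c *\<^sub>C f) = cmod c * Lp_norm p f"
  by (transfer fixing: p) (use p in \<open>simp add: integral_circle norm_mult powr_mult powr_powr\<close>)

lemma Lp_add: "f \<in> Lp p \<Longrightarrow> g \<in> Lp p \<Longrightarrow> f + g \<in> Lp p"
  unfolding Lp_def mem_Collect_eq
proof (transfer fixing: p)
  fix f g
  assume *: "ae_rel f f" "ae_rel g g"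
    "set_integrable lebesgue {-pi..pi} (\<lambda>x. cmod (f x) powr p)"
    "set_integrable lebesgue {-pi..pi} (\<lambda>x. cmod (g x) powr p)"
  then have "Lp_fun circle p f" "Lp_fun circle p g"
    using Lp_integrable_circle_iff by (auto simp: ae_rel_def)
  from Lp_fun_add[OF p this]
  show "set_integrable lebesgue {-pi..pi} (\<lambda>x. cmod (f x + g x) powr p)"
    by (simp add: integrable_circle_iff Lp_fun_def)
qed

lemma Lp_norm_add: "f \<in> Lp p \<Longrightarrow> g \<in> Lp p \<Longrightarrow> Lp_norm p (f + g) \<le> Lp_norm p f + Lp_norm p g"
  unfolding Lp_def mem_Collect_eq
proof (transfer fixing: p)
  fix f g
  assume *: "ae_rel f f" "ae_rel g g"
    "set_integrable lebesgue {-pi..pi} (\<lambda>x. cmod (f x) powr p)"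
    "set_integrable lebesgue {-pi..pi} (\<lambda>x. cmod (g x) powr p)"
  then have "Lp_fun circle p f" "Lp_fun circle p g"
    using Lp_integrable_circle_iff by (auto simp: ae_rel_def)
  from Lp_seminorm_add[OF p this]
  show "(LINT x:{-pi..pi}|lebesgue. cmod (f x + g x) powr p) powr (1 / p)
    \<le> (LINT x:{-pi..pi}|lebesgue. cmod (f x) powr p) powr (1 / p)
      + (LINT x:{-pi..pi}|lebesgue. cmod (g x) powr p) powr (1 / p)"
    by (simp add: Lp_norm_circle)
qed

lemma Lp_norm_zero: "Lp_norm p 0 = 0"
  using Lp_norm_scaleC[of 0 0] by simp

lemma Lp_zero: "0 \<in> Lp p"
  unfolding Lp_def mem_Collect_eq
  by (transfer fixing: p) (simp add: set_integrable_def)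

lemma Lp_diff: "f \<in> Lp p \<Longrightarrow> g \<in> Lp p \<Longrightarrow> f - g \<in> Lp p"
  using Lp_add[of f "(-1) *\<^sub>C g"] Lp_scaleC[of g "-1"] by simp

lemma Lp_norm_minus_commute: "Lp_norm p (f - g) = Lp_norm p (g - f)"
  using Lp_norm_scaleC[of "-1" "f - g"] by simp

lemma Lp_norm_diff: "f \<in> Lp p \<Longrightarrow> g \<in> Lp p \<Longrightarrow> Lp_norm p (f - g) \<le> Lp_norm p f + Lp_norm p g"
  using Lp_norm_add[of f "(-1) *\<^sub>C g"] Lp_scaleC[of g "-1"] Lp_norm_scaleC[of "-1" g] by simp

lemma Lp_sum: "(\<And>k. k \<in> I \<Longrightarrow> u k \<in> Lp p) \<Longrightarrow> sum u I \<in> Lp p"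
  by (induction I rule: infinite_finite_induct) (auto intro: Lp_add Lp_zero)

lemma Lp_norm_sum: "(\<And>k. k \<in> I \<Longrightarrow> u k \<in> Lp p) \<Longrightarrow> Lp_norm p (sum u I) \<le> (\<Sum>k\<in>I. Lp_norm p (u k))"
proof (induction I rule: infinite_finite_induct)
  case (insert i I)
  then show ?case
    using Lp_norm_add[of "u i" "sum u I"] by (auto intro!: Lp_sum order_trans[OF Lp_norm_add])
qed (simp_all add: Lp_norm_zero)

text \<open>A vanishing integral forces \<open>f\<close> to vanish almost everywhere on one period,
  and \<open>AE_periodic\<close> extends this to the line.\<close>

lemma Lp_norm_eq_zero: "f \<in> Lp p \<Longrightarrow> Lp_norm p f = 0 \<Longrightarrow> f = 0"
  unfolding Lp_def mem_Collect_eq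
proof (transfer fixing: p)
  fix f
  assume "ae_rel f f" and int: "set_integrable lebesgue {-pi..pi} (\<lambda>x. cmod (f x) powr p)"
    and zero: "(LINT x:{-pi..pi}|lebesgue. cmod (f x) powr p) powr (1 / p) = 0"
  then have per: "periodic_measurable f"
    by (simp add: ae_rel_def)
  have "AE x in circle. cmod (f x) powr p = 0"
    using int zero by (subst integral_nonneg_eq_0_iff_AE[symmetric])
      (auto simp: integrable_circle_iff integral_circle)
  then have "AE x in lebesgue. f x = 0"
    using per by (intro AE_periodic) (auto simp: periodic_measurable_def)
  then show "ae_rel f (\<lambda>_. 0)"
    using per by (simp add: ae_rel_def periodic_measurable_def)
qed

text \<open>Completeness on the circle is applied to representatives, and the class of their
  pointwise limit along a subsequence is the limit.\<close>

lemma Lp_space_complete: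
  assumes \<sigma>: "\<And>n. \<sigma> n \<in> Lp p"
    and Cauchy: "\<And>e. 0 < e \<Longrightarrow> \<exists>N. \<forall>m\<ge>N. \<forall>n\<ge>N. Lp_norm p (\<sigma> m - \<sigma> n) < e"
  obtains f where "f \<in> Lp p" "(\<lambda>n. Lp_norm p (\<sigma> n - f)) \<longlonglongrightarrow> 0"
proof -
  define s where "s n = rep_pfun (\<sigma> n)" for n
  have rel: "ae_rel (s n) (s n)" for n
    unfolding s_def using Quotient_rep_reflp[OF Quotient_pfun] .
  have abs: "\<sigma> n = abs_pfun (s n)" for n
    unfolding s_def using Quotient_abs_rep[OF Quotient_pfun] by simp
  have per: "periodic_measurable (s n)" for n
    using rel[of n] by (simp add: ae_rel_def)
  have s: "Lp_fun circle p (s n)" for n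
    using \<sigma>[of n] unfolding abs Lp_def mem_Collect_eq Lp_integrable.abs_eq[OF rel]
    by (simp add: Lp_integrable_circle_iff[OF per])
  have norm_diff: "Lp_norm p (\<sigma> n - abs_pfun g) = Lp_seminorm circle p (\<lambda>x. s n x - g x)"
    if "ae_rel g g" for n g
  proof -
    have "ae_rel (\<lambda>x. s n x - g x) (\<lambda>x. s n x - g x)"
      using rel[of n] that by (auto simp: ae_rel_def periodic_measurable_def)
    then show ?thesis
      unfolding abs minus_pfun.abs_eq[OF rel that] by (simp add: Lp_norm.abs_eq Lp_norm_circle)
  qed
  have diff_eq: "Lp_seminorm circle p (\<lambda>x. s m x - s n x) = Lp_norm p (\<sigma> m - \<sigma> n)" for m n
    using norm_diff[OF rel, of m n] abs by simp
  obtain \<phi> where \<phi>: "Lp_fun circle p (\<lambda>x. lim (\<lambda>i. s (\<phi> i) x))"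
    "(\<lambda>n. Lp_seminorm circle p (\<lambda>x. s n x - lim (\<lambda>i. s (\<phi> i) x))) \<longlonglongrightarrow> 0"
    by (rule Lp_complete[OF finite_measure_circle p s]) (use Cauchy in \<open>simp_all add: diff_eq\<close>)
  define g where "g x = lim (\<lambda>i. s (\<phi> i) x)" for x
  \<comment> \<open>At \<open>x\<close> and \<open>x + 2 * pi\<close> the same sequence of values is
    passed to \<open>lim\<close>, so \<open>g\<close> is periodic even where that sequence
    diverges.\<close>
  have "periodic_measurable g"
    using per unfolding g_def periodic_measurable_def by (auto intro: borel_measurable_lim_metric)
  then have g: "ae_rel g g"
    by (simp add: ae_rel_def)
  show ?thesis
  proof
    show "abs_pfun g \<in> Lp p"
      unfolding Lp_def mem_Collect_eq Lp_integrable.abs_eq[OF g]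
        Lp_integrable_circle_iff[OF \<open>periodic_measurable g\<close>]
      using \<phi>(1) by (simp add: g_def[abs_def])
    show "(\<lambda>n. Lp_norm p (\<sigma> n - abs_pfun g)) \<longlonglongrightarrow> 0"
      unfolding norm_diff[OF g] using \<phi>(2) by (simp add: g_def)
  qed
qed

end

subsection \<open>Fourier coefficients and partial sums\<close>

lemma periodic_measurable_trig_poly:
  "periodic_measurable (\<lambda>t. a 0 / 2 +
     (\<Sum>k=1..n. a k * complex_of_real (cos (real k * t)) + b k * complex_of_real (sin (real k * t))))"
  using trig_poly.rsp by (auto simp: rel_fun_def ae_rel_def)

lemma ae_rel_reflI: "periodic_measurable f \<Longrightarrow> f = g \<Longrightarrow> ae_rel f g"
  by (simp add: ae_rel_def)

lemma trig_poly_add: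
  "trig_poly (\<lambda>k. a k + a' k) (\<lambda>k. b k + b' k) n = trig_poly a b n + trig_poly a' b' n"
proof transfer
  fix a a' b b' :: "nat \<Rightarrow> complex" and n
  let ?T = "\<lambda>a b t. a 0 / 2 +
    (\<Sum>k=1..n. a k * complex_of_real (cos (real k * t)) + b k * complex_of_real (sin (real k * t)))"
  have "?T (\<lambda>k. a k + a' k) (\<lambda>k. b k + b' k) = (\<lambda>t. ?T a b t + ?T a' b' t)"
    by (simp add: fun_eq_iff algebra_simps sum.distrib add_divide_distrib)
  then show "ae_rel (?T (\<lambda>k. a k + a' k) (\<lambda>k. b k + b' k)) (\<lambda>t. ?T a b t + ?T a' b' t)"
    by (rule ae_rel_reflI[OF periodic_measurable_trig_poly[of "\<lambda>k. a k + a' k" "\<lambda>k. b k + b' k" n]])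
qed

lemma trig_poly_scaleC: "trig_poly (\<lambda>k. c * a k) (\<lambda>k. c * b k) n = c *\<^sub>C trig_poly a b n"
proof transfer
  fix c :: complex and a b :: "nat \<Rightarrow> complex" and n
  let ?T = "\<lambda>a b t. a 0 / 2 +
    (\<Sum>k=1..n. a k * complex_of_real (cos (real k * t)) + b k * complex_of_real (sin (real k * t)))"
  have "?T (\<lambda>k. c * a k) (\<lambda>k. c * b k) = (\<lambda>t. c * ?T a b t)"
    by (simp add: fun_eq_iff algebra_simps sum.distrib sum_distrib_left)
  then show "ae_rel (?T (\<lambda>k. c * a k) (\<lambda>k. c * b k)) (\<lambda>t. c * ?T a b t)"
    by (rule ae_rel_reflI[OF periodic_measurable_trig_poly[of "\<lambda>k. c * a k" "\<lambda>k. c * b k" n]])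
qed

text \<open>The coefficient 2 is due to the halving of the constant term.\<close>

abbreviation one_pfun :: pfun where
  "one_pfun \<equiv> trig_poly (\<lambda>_. 2) (\<lambda>_. 0) 0"

text \<open>Sine and cosine are bounded by 1. Majorization by a constant function gives membership
  in L^p and a norm bound in terms of the coefficients.\<close>

lemma trig_poly_majorized:
  "trig_poly a b n \<preceq> complex_of_real (cmod (a 0) / 2 + (\<Sum>k=1..n. cmod (a k) + cmod (b k))) *\<^sub>C one_pfun"
proof (transfer, rule AE_I2)
  fix a b :: "nat \<Rightarrow> complex" and n :: nat and t :: real
  have "cmod (a 0 / 2 + (\<Sum>k=1..n. a k * complex_of_real (cos (real k * t))
      + b k * complex_of_real (sin (real k * t))))
    \<le> cmod (a 0) / 2 + (\<Sum>k=1..n. cmod (a k) + cmod (b k))"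
    by (intro norm_triangle_le add_mono sum_norm_le)
      (auto simp: norm_mult norm_divide abs_cos_le_one abs_sin_le_one intro!: norm_triangle_le add_mono mult_left_le)
  then show "cmod (a 0 / 2 + (\<Sum>k=1..n. a k * complex_of_real (cos (real k * t))
      + b k * complex_of_real (sin (real k * t))))
    \<le> Re (complex_of_real (cmod (a 0) / 2 + (\<Sum>k=1..n. cmod (a k) + cmod (b k))) *
        (2 / 2 + (\<Sum>k=1..0. 2 * complex_of_real (cos (real k * t)) + 0 * complex_of_real (sin (real k * t)))))"
    by simp
qed

section \<open>Linearity and boundedness of Fourier coefficients and partial sums\<close>

lemma integrable_mult_bounded:
  fixes f :: "'a \<Rightarrow> complex" and c :: "'a \<Rightarrow> real"
  assumes "integrable M f" "c \<in> borel_measurable M" "\<And>t. \<bar>c t\<bar> \<le> 1"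
  shows "integrable M (\<lambda>t. f t * complex_of_real (c t))"
  by (rule Bochner_Integration.integrable_bound[OF assms(1)])
    (use assms in \<open>auto simp: norm_mult intro!: mult_left_le borel_measurable_times borel_measurable_of_real\<close>)

lemma norm_integral_mult_bounded:
  fixes f :: "'a \<Rightarrow> complex" and c :: "'a \<Rightarrow> real"
  assumes "integrable M f" "c \<in> borel_measurable M" "\<And>t. \<bar>c t\<bar> \<le> 1"
  shows "cmod (LINT t|M. f t * complex_of_real (c t)) \<le> (LINT t|M. cmod (f t))"
  by (rule order_trans[OF integral_norm_bound integral_mono])
    (use integrable_norm[OF integrable_mult_bounded[OF assms]] assms in \<open>auto simp: norm_mult intro!: mult_left_le\<close>)

lemma trig_measurable_circle:
  "(\<lambda>t. cos (real k * t)) \<in> borel_measurable circle" "(\<lambda>t. sin (real k * t)) \<in> borel_measurable circle"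
  by (intro measurable_restrict_space1 measurable_completion; measurable)+

context
  fixes p :: real
  assumes p: "1 \<le> p"
begin

lemma integrable_circle_of_Lp:
  assumes "ae_rel f f" "set_integrable lebesgue {-pi..pi} (\<lambda>x. cmod (f x) powr p)"
  shows "integrable circle f"
  using Lp_fun_integrable[OF finite_measure_circle p] Lp_integrable_circle_iff assms
  unfolding ae_rel_def by blast

lemma fourier_add:
  assumes "f \<in> Lp p" "g \<in> Lp p"
  shows "fourier_a (f + g) = (\<lambda>k. fourier_a f k + fourier_a g k)"
    "fourier_b (f + g) = (\<lambda>k. fourier_b f k + fourier_b g k)"
  using assms unfolding Lp_def mem_Collect_eq
  by (transfer fixing: p,
      auto simp: fun_eq_iff integral_circle distrib_right add_divide_distrib
        integrable_mult_bounded integrable_circle_of_Lp trig_measurable_circle)+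

lemma fourier_scaleC:
  "fourier_a (c *\<^sub>C f) = (\<lambda>k. c * fourier_a f k)" "fourier_b (c *\<^sub>C f) = (\<lambda>k. c * fourier_b f k)"
  by (transfer, simp add: fun_eq_iff integral_circle mult.assoc)+

text \<open>A coefficient is at most the L^1 norm over one period divided by \<open>pi\<close>, and
  the L^1 norm is controlled by the L^p norm.\<close>

lemma fourier_bound:
  assumes "f \<in> Lp p"
  shows "cmod (fourier_a f k) \<le> (measure circle (space circle) + 1) / pi * Lp_norm p f"
    "cmod (fourier_b f k) \<le> (measure circle (space circle) + 1) / pi * Lp_norm p f"
proof -
  define C where "C = measure circle (space circle) + 1"
  have "cmod (fourier_a f k) \<le> C / pi * Lp_norm p f \<and> cmod (fourier_b f k) \<le> C / pi * Lp_norm p f"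
    using assms unfolding Lp_def mem_Collect_eq
  proof (transfer fixing: p C k)
    fix f
    assume f: "ae_rel f f" "set_integrable lebesgue {-pi..pi} (\<lambda>x. cmod (f x) powr p)"
    then have Lp: "Lp_fun circle p f"
      using Lp_integrable_circle_iff by (auto simp: ae_rel_def)
    have "cmod (LINT t|circle. f t * complex_of_real (c t)) / pi \<le> C * Lp_seminorm circle p f / pi"
      if "c \<in> borel_measurable circle" "\<And>t. \<bar>c t\<bar> \<le> 1" for c
      using norm_integral_mult_bounded[OF integrable_circle_of_Lp[OF f] that]
        L1_le_Lp_seminorm[OF finite_measure_circle p Lp]
      by (intro divide_right_mono) (auto simp: C_def)
    from this[of "\<lambda>t. cos (real k * t)"] this[of "\<lambda>t. sin (real k * t)"]
    show "cmod ((LINT t:{-pi..pi}|lebesgue. f t * complex_of_real (cos (real k * t))) / complex_of_real pi)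
         \<le> C / pi * (LINT x:{-pi..pi}|lebesgue. cmod (f x) powr p) powr (1 / p) \<and>
       cmod ((LINT t:{-pi..pi}|lebesgue. f t * complex_of_real (sin (real k * t))) / complex_of_real pi)
         \<le> C / pi * (LINT x:{-pi..pi}|lebesgue. cmod (f x) powr p) powr (1 / p)"
      unfolding Lp_norm_circle unfolding integral_circle
      by (simp add: norm_divide trig_measurable_circle)
  qed
  then show "cmod (fourier_a f k) \<le> (measure circle (space circle) + 1) / pi * Lp_norm p f"
    "cmod (fourier_b f k) \<le> (measure circle (space circle) + 1) / pi * Lp_norm p f"
    by (auto simp: C_def)
qed

lemma one_pfun_Lp: "one_pfun \<in> Lp p"
  unfolding Lp_def mem_Collect_eq
  by (transfer fixing: p) (simp add: integrable_circle_iff)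

lemma partial_sum_Lp: "partial_sum k f \<in> Lp p"
  unfolding partial_sum_def
  by (rule Lp_majorized[OF p trig_poly_majorized Lp_scaleC[OF p one_pfun_Lp]])

lemma partial_sum_add:
  "f \<in> Lp p \<Longrightarrow> g \<in> Lp p \<Longrightarrow> partial_sum k (f + g) = partial_sum k f + partial_sum k g"
  by (simp add: partial_sum_def fourier_add trig_poly_add)

lemma partial_sum_scaleC: "partial_sum k (c *\<^sub>C f) = c *\<^sub>C partial_sum k f"
  by (simp add: partial_sum_def fourier_scaleC trig_poly_scaleC)

text \<open>The norm of \<open>f\<close> bounds the coefficients, and these bound the partial sum.
  The constant depends on \<open>k\<close>, which is harmless at a fixed index.\<close>

lemma partial_sum_bounded:
  obtains C where "\<And>f. f \<in> Lp p \<Longrightarrow> Lp_norm p (partial_sum k f) \<le> C * Lp_norm p f"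
proof -
  define D where "D = (measure circle (space circle) + 1) / pi"
  have "Lp_norm p (partial_sum k f) \<le> (D / 2 + (\<Sum>j=1..k. D + D)) * Lp_norm p one_pfun * Lp_norm p f"
    if "f \<in> Lp p" for f
  proof -
    let ?K = "cmod (fourier_a f 0) / 2 + (\<Sum>j=1..k. cmod (fourier_a f j) + cmod (fourier_b f j))"
    have "0 \<le> ?K"
      by (intro add_nonneg_nonneg sum_nonneg) auto
    then have "Lp_norm p (partial_sum k f) \<le> ?K * Lp_norm p one_pfun"
      using Lp_norm_majorized[OF p trig_poly_majorized Lp_scaleC[OF p one_pfun_Lp],
          of "fourier_a f" "fourier_b f" k]
      unfolding Lp_norm_scaleC[OF p] partial_sum_def norm_of_real by simp
    also have "\<dots> \<le> (D * Lp_norm p f / 2 + (\<Sum>j=1..k. D * Lp_norm p f + D * Lp_norm p f))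
        * Lp_norm p one_pfun"
      using fourier_bound[OF that]
      by (intro mult_right_mono add_mono divide_right_mono sum_mono) (auto simp: D_def Lp_norm_nonneg[OF p])
    also have "\<dots> = (D / 2 + (\<Sum>j=1..k. D + D)) * Lp_norm p one_pfun * Lp_norm p f"
      by (simp add: algebra_simps)
    finally show ?thesis .
  qed
  then show ?thesis
    using that by blast
qed

end

subsection \<open>Lagged differences\<close>

lemma lag_Suc_Suc: "lag (Suc r) a (Suc n) = lag r a n"
  by (simp add: lag_def)

lemma lag_0: "lag 0 a = a"
  by (simp add: lag_def fun_eq_iff)

text \<open>Increasing the lag by one shifts the lagged sequence by one place, so the sum
  telescopes; its lower end contributes 0.\<close>

lemma sum_lag_diff_Suc:
  fixes a :: "nat \<Rightarrow> 'a::ab_group_add"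
  shows "(\<Sum>k=0..n. lag r a k - lag (Suc r) a k) = lag r a n"
proof (induction n)
  case 0
  show ?case by (simp add: lag_def)
next
  case (Suc n)
  then show ?case by (simp add: lag_Suc_Suc)
qed

lemma lag_le:
  assumes "incseq a" "\<And>k. 0 \<le> a k"
  shows "lag r a n \<le> (a n :: real)"
  using assms by (auto simp: lag_def incseq_def)

text \<open>A difference of lag \<open>r\<close> splits into \<open>r\<close> differences of
  consecutive lags. Each of them sums to a single lagged term, which monotonicity bounds by
  \<open>a n\<close>.\<close>

lemma sum_lag_diff_le:
  fixes a :: "nat \<Rightarrow> real"
  assumes "incseq a" "\<And>k. 0 \<le> a k"
  shows "(\<Sum>k=0..n. a k - lag r a k) \<le> real r * a n"
proof (induction r)
  case 0
  show ?case by (simp add: lag_0)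
next
  case (Suc r)
  have "(\<Sum>k=0..n. a k - lag (Suc r) a k)
      = (\<Sum>k=0..n. a k - lag r a k) + (\<Sum>k=0..n. lag r a k - lag (Suc r) a k)"
    by (simp flip: sum.distrib)
  also have "\<dots> \<le> real r * a n + a n"
    unfolding sum_lag_diff_Suc using Suc lag_le[OF assms] by (intro add_mono)
  finally show ?case by (simp add: algebra_simps)
qed

text \<open>The index set consists of \<open>n\<close>, \<open>n - r\<close>,
  \<open>n - 2 * r\<close> and so on, ending below \<open>r\<close>, where the lagged term is
  0.\<close>

lemma lag_telescope:
  fixes a :: "nat \<Rightarrow> 'a::ab_group_add"
  assumes "0 < r"
  obtains I where "I \<subseteq> {0..n}" "a n = (\<Sum>k\<in>I. a k - lag r a k)"
proof -
  have "\<exists>I\<subseteq>{0..n}. a n = (\<Sum>k\<in>I. a k - lag r a k)"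
  proof (induction n rule: less_induct)
    case (less n)
    show ?case
    proof (cases "n < r")
      case True
      then show ?thesis
        by (intro exI[of _ "{n}"]) (simp add: lag_def)
    next
      case False
      then obtain I where I: "I \<subseteq> {0..n - r}" "a (n - r) = (\<Sum>k\<in>I. a k - lag r a k)"
        using less[of "n - r"] assms by auto
      then have "n \<notin> I" "finite I"
        using False assms by (auto intro: finite_subset)
      then have "a n = (\<Sum>k\<in>insert n I. a k - lag r a k)"
        using I False by (simp add: lag_def)
      moreover have "insert n I \<subseteq> {0..n}"
        using I by auto
      ultimately show ?thesis by blast
    qed
  qed
  then show ?thesis
    using that by blast
qed

lemma lag_scaleC:
  "lag r (\<lambda>k. complex_of_real (a k) *\<^sub>C u k) k = complex_of_real (lag r a k) *\<^sub>C lag r u k"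
  by (simp add: lag_def)

text \<open>For \<open>k < r\<close> the bracket on the right is \<open>- f\<close> and not 0, but
  its weight vanishes.\<close>

lemma lag_scaleC_diff:
  "lag r (\<lambda>k. complex_of_real (a k) *\<^sub>C (u k - f)) k = complex_of_real (lag r a k) *\<^sub>C (lag r u k - f)"
  by (simp add: lag_def)

subsection \<open>Means of moduli\<close>

text \<open>Common form of \<open>sum_mean\<close> and \<open>dev_mean\<close>, so that the seminorm
  properties and the telescoping bound are proved once for both.\<close>

definition abs_mean :: "(nat \<Rightarrow> real) \<Rightarrow> (nat \<Rightarrow> pfun) \<Rightarrow> nat \<Rightarrow> pfun" where
  "abs_mean \<Lambda> u n = complex_of_real (1 / \<Lambda> n) *\<^sub>C (\<Sum>k=0..n. modulus (u k))"

locale strong_means =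
  fixes \<Lambda> :: "nat \<Rightarrow> real" and r :: nat and p :: real
  assumes mono: "incseq \<Lambda>" and pos: "\<And>k. 0 < \<Lambda> k" and r: "0 < r" and p: "1 \<le> p"
begin

lemma abs_mean_Lp: "(\<And>k. u k \<in> Lp p) \<Longrightarrow> abs_mean \<Lambda> u n \<in> Lp p"
  unfolding abs_mean_def by (intro Lp_scaleC[OF p] Lp_sum[OF p]) (simp add: Lp_modulus[OF p])

lemma abs_mean_add:
  assumes "\<And>k. u k \<in> Lp p" "\<And>k. v k \<in> Lp p"
  shows "Lp_norm p (abs_mean \<Lambda> (\<lambda>k. u k + v k) n)
    \<le> Lp_norm p (abs_mean \<Lambda> u n) + Lp_norm p (abs_mean \<Lambda> v n)"
proof -
  have "(\<Sum>k=0..n. modulus (u k + v k)) \<preceq> (\<Sum>k=0..n. modulus (u k) + modulus (v k))"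
    by (intro majorized_sum modulus_add)
  then have "abs_mean \<Lambda> (\<lambda>k. u k + v k) n \<preceq> abs_mean \<Lambda> u n + abs_mean \<Lambda> v n"
    unfolding abs_mean_def sum.distrib pfun.scale_right_distrib[symmetric]
    by (intro majorized_scaleC) (simp_all add: less_imp_le[OF pos])
  from Lp_norm_majorized[OF p this] show ?thesis
    using Lp_norm_add[OF p abs_mean_Lp abs_mean_Lp, of u v n n] Lp_add[OF p abs_mean_Lp abs_mean_Lp, of u v n n]
      assms by simp
qed

lemma abs_mean_scaleC:
  "Lp_norm p (abs_mean \<Lambda> (\<lambda>k. c *\<^sub>C u k) n) = cmod c * Lp_norm p (abs_mean \<Lambda> u n)"
proof -
  have "abs_mean \<Lambda> (\<lambda>k. c *\<^sub>C u k) n = complex_of_real (cmod c) *\<^sub>C abs_mean \<Lambda> u n"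
    unfolding abs_mean_def modulus_scaleC
    by (simp add: mult.commute flip: pfun.scale_sum_right)
  then show ?thesis
    by (simp add: Lp_norm_scaleC[OF p])
qed

lemma abs_mean_le:
  assumes "\<And>k. u k \<in> Lp p"
  shows "Lp_norm p (abs_mean \<Lambda> u n) \<le> (\<Sum>k=0..n. Lp_norm p (u k)) / \<Lambda> n"
  using Lp_norm_sum[OF p, of "{0..n}" "\<lambda>k. modulus (u k)"] assms pos[of n]
  by (simp add: abs_mean_def Lp_norm_scaleC[OF p] Lp_modulus[OF p] Lp_norm_modulus[OF p]
      norm_divide divide_right_mono)

text \<open>By \<open>lag_telescope\<close> the term \<open>a n\<close> is a sum of some of the
  differences, hence majorized by the sum of the moduli of all of them.\<close>

lemma abs_mean_telescope:
  assumes "\<And>k. a k - lag r a k \<in> Lp p"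
  shows "Lp_norm p (a n) / \<Lambda> n \<le> Lp_norm p (abs_mean \<Lambda> (\<lambda>k. a k - lag r a k) n)"
proof -
  obtain I where I: "I \<subseteq> {0..n}" "a n = (\<Sum>k\<in>I. a k - lag r a k)"
    using lag_telescope[OF r, of n a] .
  have "a n \<preceq> (\<Sum>k=0..n. modulus (a k - lag r a k))"
    unfolding I(2) by (rule sum_majorized_sum_modulus) (use I in auto)
  moreover have "(\<Sum>k=0..n. modulus (a k - lag r a k)) \<in> Lp p"
    by (rule Lp_sum[OF p]) (simp add: Lp_modulus[OF p] assms)
  ultimately have "Lp_norm p (a n) \<le> Lp_norm p (\<Sum>k=0..n. modulus (a k - lag r a k))"
    by (rule Lp_norm_majorized[OF p])
  then show ?thesis
    using pos[of n] by (simp add: abs_mean_def Lp_norm_scaleC[OF p] norm_divide divide_right_mono)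
qed

section \<open>Weighted partial sums and weighted deviations\<close>

definition wdiff :: "pfun \<Rightarrow> nat \<Rightarrow> pfun" where
  "wdiff f k = complex_of_real (\<Lambda> k) *\<^sub>C partial_sum k f
     - complex_of_real (lag r \<Lambda> k) *\<^sub>C lag r (\<lambda>j. partial_sum j f) k"

definition wdev :: "pfun \<Rightarrow> nat \<Rightarrow> pfun" where
  "wdev f k = complex_of_real (\<Lambda> k) *\<^sub>C (partial_sum k f - f)
     - complex_of_real (lag r \<Lambda> k) *\<^sub>C (lag r (\<lambda>j. partial_sum j f) k - f)"

lemma sum_mean_eq: "sum_mean \<Lambda> r f n = abs_mean \<Lambda> (wdiff f) n"
  by (simp add: sum_mean_def abs_mean_def wdiff_def)

lemma dev_mean_eq: "dev_mean \<Lambda> r f n = abs_mean \<Lambda> (wdev f) n"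
  by (simp add: dev_mean_def abs_mean_def wdev_def)

text \<open>The two weighted sequences differ only by scalar multiples of \<open>f\<close>, which is
  what makes the two means comparable.\<close>

lemma wdev_eq: "wdev f k = wdiff f k + complex_of_real (- (\<Lambda> k - lag r \<Lambda> k)) *\<^sub>C f"
  by (simp add: wdev_def wdiff_def pfun.scale_right_diff_distrib pfun.scale_left_diff_distrib)

lemma lag_partial_sum_Lp: "lag r (\<lambda>j. partial_sum j f) k \<in> Lp p"
  by (simp add: lag_def Lp_zero[OF p] partial_sum_Lp[OF p])

lemma wdiff_Lp: "wdiff f k \<in> Lp p"
  unfolding wdiff_def by (intro Lp_diff[OF p] Lp_scaleC[OF p] partial_sum_Lp[OF p] lag_partial_sum_Lp)

lemma wdev_Lp: "f \<in> Lp p \<Longrightarrow> wdev f k \<in> Lp p"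
  unfolding wdev_eq by (intro Lp_add[OF p] Lp_scaleC[OF p] wdiff_Lp)

lemma wdiff_add: "f \<in> Lp p \<Longrightarrow> g \<in> Lp p \<Longrightarrow> wdiff (f + g) = (\<lambda>k. wdiff f k + wdiff g k)"
  by (rule ext) (simp add: wdiff_def partial_sum_add[OF p] lag_def pfun.scale_right_distrib)

lemma wdiff_scaleC: "wdiff (c *\<^sub>C f) = (\<lambda>k. c *\<^sub>C wdiff f k)"
  by (rule ext) (simp add: wdiff_def partial_sum_scaleC[OF p] lag_def pfun.scale_right_diff_distrib mult.commute)

lemma wdev_add: "f \<in> Lp p \<Longrightarrow> g \<in> Lp p \<Longrightarrow> wdev (f + g) = (\<lambda>k. wdev f k + wdev g k)"
  by (rule ext) (simp only: wdev_eq wdiff_add pfun.scale_right_distrib add_ac)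

lemma wdev_scaleC: "wdev (c *\<^sub>C f) = (\<lambda>k. c *\<^sub>C wdev f k)"
  by (rule ext) (simp only: wdev_eq wdiff_scaleC pfun.scale_right_distrib pfun.scale_scale mult.commute)

definition sum_norm :: "pfun \<Rightarrow> nat \<Rightarrow> real" where
  "sum_norm f n = Lp_norm p (sum_mean \<Lambda> r f n)"

definition dev_norm :: "pfun \<Rightarrow> nat \<Rightarrow> real" where
  "dev_norm f n = Lp_norm p (dev_mean \<Lambda> r f n)"

lemma sum_norm_nonneg: "0 \<le> sum_norm f n" and dev_norm_nonneg: "0 \<le> dev_norm f n"
  by (simp_all add: sum_norm_def dev_norm_def Lp_norm_nonneg[OF p])

lemma sum_norm_add: "f \<in> Lp p \<Longrightarrow> g \<in> Lp p \<Longrightarrow> sum_norm (f + g) n \<le> sum_norm f n + sum_norm g n"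
  unfolding sum_norm_def sum_mean_eq by (simp add: wdiff_add abs_mean_add wdiff_Lp)

lemma dev_norm_add: "f \<in> Lp p \<Longrightarrow> g \<in> Lp p \<Longrightarrow> dev_norm (f + g) n \<le> dev_norm f n + dev_norm g n"
  unfolding dev_norm_def dev_mean_eq by (simp add: wdev_add abs_mean_add wdev_Lp)

lemma sum_norm_scaleC: "sum_norm (c *\<^sub>C f) n = cmod c * sum_norm f n"
  unfolding sum_norm_def sum_mean_eq wdiff_scaleC by (rule abs_mean_scaleC)

lemma dev_norm_scaleC: "dev_norm (c *\<^sub>C f) n = cmod c * dev_norm f n"
  unfolding dev_norm_def dev_mean_eq wdev_scaleC by (rule abs_mean_scaleC)

text \<open>The moduli of the weights sum to at most \<open>real r * \<Lambda> n\<close>.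
  Prescribing only the modulus of \<open>w\<close> covers both signs, one for each direction of the
  comparison of \<open>sum_norm\<close> and \<open>dev_norm\<close>.\<close>

lemma abs_mean_lag_diff:
  assumes "f \<in> Lp p" "\<And>k. \<bar>w k\<bar> = \<Lambda> k - lag r \<Lambda> k"
  shows "Lp_norm p (abs_mean \<Lambda> (\<lambda>k. complex_of_real (w k) *\<^sub>C f) n) \<le> real r * Lp_norm p f"
proof -
  have "Lp_norm p (abs_mean \<Lambda> (\<lambda>k. complex_of_real (w k) *\<^sub>C f) n)
      \<le> (\<Sum>k=0..n. Lp_norm p (complex_of_real (w k) *\<^sub>C f)) / \<Lambda> n"
    by (rule abs_mean_le) (rule Lp_scaleC[OF p assms(1)])
  also have "\<dots> = (\<Sum>k=0..n. \<Lambda> k - lag r \<Lambda> k) * Lp_norm p f / \<Lambda> n"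
    by (simp only: Lp_norm_scaleC[OF p] norm_of_real assms(2) sum_distrib_right)
  also have "\<dots> \<le> real r * \<Lambda> n * Lp_norm p f / \<Lambda> n"
    using sum_lag_diff_le[OF mono less_imp_le[OF pos]] pos[of n]
    by (intro divide_right_mono mult_right_mono) (auto simp: Lp_norm_nonneg[OF p])
  finally show ?thesis
    using pos[of n] by simp
qed

lemma lag_weight_le: "lag r \<Lambda> k \<le> \<Lambda> k"
  by (rule lag_le[OF mono less_imp_le[OF pos]])

lemma dev_norm_le: "f \<in> Lp p \<Longrightarrow> dev_norm f n \<le> sum_norm f n + real r * Lp_norm p f"
  using abs_mean_add[of "wdiff f" "\<lambda>k. complex_of_real (- (\<Lambda> k - lag r \<Lambda> k)) *\<^sub>C f" n]
    abs_mean_lag_diff[of f "\<lambda>k. - (\<Lambda> k - lag r \<Lambda> k)" n] lag_weight_le wdiff_Lp Lp_scaleC[OF p]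
  unfolding dev_norm_def sum_norm_def dev_mean_eq sum_mean_eq wdev_eq[abs_def] by fastforce

lemma sum_norm_le:
  assumes "f \<in> Lp p"
  shows "sum_norm f n \<le> dev_norm f n + real r * Lp_norm p f"
proof -
  have "wdiff f = (\<lambda>k. wdev f k + complex_of_real (\<Lambda> k - lag r \<Lambda> k) *\<^sub>C f)"
    by (rule ext) (simp only: wdev_eq of_real_minus pfun.scale_minus_left add.assoc left_minus add_0_right)
  then show ?thesis
    using abs_mean_add[of "wdev f" "\<lambda>k. complex_of_real (\<Lambda> k - lag r \<Lambda> k) *\<^sub>C f" n]
      abs_mean_lag_diff[of f "\<lambda>k. \<Lambda> k - lag r \<Lambda> k" n] lag_weight_le wdev_Lp Lp_scaleC[OF p] assms
    unfolding dev_norm_def sum_norm_def dev_mean_eq sum_mean_eq by fastforce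
qed

text \<open>Exhibits the weighted terms as lagged differences of a single sequence, the shape that
  \<open>abs_mean_telescope\<close> expects.\<close>

lemma wdiff_lag: "wdiff f k = complex_of_real (\<Lambda> k) *\<^sub>C partial_sum k f
    - lag r (\<lambda>k. complex_of_real (\<Lambda> k) *\<^sub>C partial_sum k f) k"
  unfolding lag_scaleC wdiff_def ..

lemma wdev_lag: "wdev f k = complex_of_real (\<Lambda> k) *\<^sub>C (partial_sum k f - f)
    - lag r (\<lambda>k. complex_of_real (\<Lambda> k) *\<^sub>C (partial_sum k f - f)) k"
  unfolding lag_scaleC_diff wdev_def ..

lemma partial_sum_le_sum_norm: "Lp_norm p (partial_sum n f) \<le> sum_norm f n"
  using abs_mean_telescope[of "\<lambda>k. complex_of_real (\<Lambda> k) *\<^sub>C partial_sum k f" n] wdiff_Lp[of f] pos[of n]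
  by (simp add: sum_norm_def sum_mean_eq Lp_norm_scaleC[OF p] flip: wdiff_lag)

text \<open>Telescoping applied to the weighted deviations, where the factor
  \<open>\<Lambda> n\<close> cancels. For \<open>f\<close> in \<open>Sp p \<Lambda> r\<close> it
  shows that the Fourier series converges to \<open>f\<close> in L^p.\<close>

lemma partial_sum_diff_le_dev_norm:
  "f \<in> Lp p \<Longrightarrow> Lp_norm p (partial_sum n f - f) \<le> dev_norm f n"
  using abs_mean_telescope[of "\<lambda>k. complex_of_real (\<Lambda> k) *\<^sub>C (partial_sum k f - f)" n] wdev_Lp[of f] pos[of n]
  by (simp add: dev_norm_def dev_mean_eq Lp_norm_scaleC[OF p] flip: wdev_lag)

text \<open>For fixed \<open>n\<close> only finitely many partial sums occur, each bounded on L^p.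
  The constant depends on \<open>n\<close>; the bound serves to pass to an L^p limit inside a single
  mean.\<close>

lemma sum_norm_bounded:
  obtains K where "\<And>f. f \<in> Lp p \<Longrightarrow> sum_norm f n \<le> K * Lp_norm p f"
proof -
  have "\<exists>C. \<forall>f\<in>Lp p. Lp_norm p (partial_sum k f) \<le> C * Lp_norm p f" for k
    using partial_sum_bounded[OF p, of k] by metis
  then obtain C where C: "\<And>k f. f \<in> Lp p \<Longrightarrow> Lp_norm p (partial_sum k f) \<le> C k * Lp_norm p f"
    by metis
  have lagC: "Lp_norm p (lag r (\<lambda>j. partial_sum j f) k) \<le> lag r C k * Lp_norm p f" if "f \<in> Lp p" for f k
    using C[OF that] by (simp add: lag_def Lp_norm_zero[OF p])
  have lag0: "0 \<le> lag r \<Lambda> k" for k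
    by (simp add: lag_def less_imp_le[OF pos])
  define D where "D k = \<Lambda> k * C k + lag r \<Lambda> k * lag r C k" for k
  have D: "Lp_norm p (wdiff f k) \<le> D k * Lp_norm p f" if "f \<in> Lp p" for f k
  proof -
    have "Lp_norm p (wdiff f k) \<le> \<Lambda> k * Lp_norm p (partial_sum k f)
        + lag r \<Lambda> k * Lp_norm p (lag r (\<lambda>j. partial_sum j f) k)"
      using Lp_norm_diff[OF p Lp_scaleC[OF p partial_sum_Lp[OF p]] Lp_scaleC[OF p lag_partial_sum_Lp],
          of "complex_of_real (\<Lambda> k)" k f "complex_of_real (lag r \<Lambda> k)" f k]
      by (simp add: wdiff_def Lp_norm_scaleC[OF p] less_imp_le[OF pos] lag0)
    also have "\<dots> \<le> \<Lambda> k * (C k * Lp_norm p f) + lag r \<Lambda> k * (lag r C k * Lp_norm p f)"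
      by (intro add_mono mult_left_mono C lagC that lag0 less_imp_le[OF pos])
    finally show ?thesis
      by (simp add: D_def algebra_simps)
  qed
  show ?thesis
  proof (rule that)
    fix f assume f: "f \<in> Lp p"
    have "sum_norm f n \<le> (\<Sum>k=0..n. Lp_norm p (wdiff f k)) / \<Lambda> n"
      unfolding sum_norm_def sum_mean_eq by (rule abs_mean_le[OF wdiff_Lp])
    also have "\<dots> \<le> (\<Sum>k=0..n. D k * Lp_norm p f) / \<Lambda> n"
      using D[OF f] pos[of n] by (intro divide_right_mono sum_mono) (auto simp: less_imp_le)
    also have "\<dots> = (\<Sum>k=0..n. D k) / \<Lambda> n * Lp_norm p f"
      by (simp add: sum_distrib_right)
    finally show "sum_norm f n \<le> (\<Sum>k=0..n. D k) / \<Lambda> n * Lp_norm p f" .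
  qed
qed

subsection \<open>The space \<open>Sp\<close>\<close>

lemma Sp_iff: "f \<in> Sp p \<Lambda> r \<longleftrightarrow> f \<in> Lp p \<and> dev_norm f \<longlonglongrightarrow> 0"
  by (simp add: Sp_def dev_norm_def[abs_def])

lemma Sp_Lp: "f \<in> Sp p \<Lambda> r \<Longrightarrow> f \<in> Lp p"
  by (simp add: Sp_iff)

lemma Sp_norm_eq: "Sp_norm p \<Lambda> r f = (SUP n. sum_norm f n)"
  by (simp add: Sp_norm_def sum_norm_def)

text \<open>The deviations form a null sequence, hence a bounded one, and \<open>sum_norm_le\<close>
  transfers the bound.\<close>

lemma bdd_above_sum_norm:
  assumes "f \<in> Sp p \<Lambda> r"
  shows "bdd_above (range (sum_norm f))"
proof -
  obtain B where B: "\<And>n. dev_norm f n \<le> B"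
    using assms convergent_imp_Bseq[of "dev_norm f"] unfolding Sp_iff convergent_def Bseq_def real_norm_def
    by (meson abs_le_D1)
  show ?thesis
    using sum_norm_le[OF Sp_Lp[OF assms]] B
    by (intro bdd_aboveI2[of _ _ "B + real r * Lp_norm p f"]) (meson add_right_mono order_trans)
qed

lemma sum_norm_le_Sp_norm: "f \<in> Sp p \<Lambda> r \<Longrightarrow> sum_norm f n \<le> Sp_norm p \<Lambda> r f"
  unfolding Sp_norm_eq by (rule cSUP_upper[OF _ bdd_above_sum_norm]) auto

lemma Sp_norm_least: "(\<And>n. sum_norm f n \<le> c) \<Longrightarrow> Sp_norm p \<Lambda> r f \<le> c"
  unfolding Sp_norm_eq by (rule cSUP_least) auto

lemma Sp_norm_nonneg: "f \<in> Sp p \<Lambda> r \<Longrightarrow> 0 \<le> Sp_norm p \<Lambda> r f"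
  using sum_norm_le_Sp_norm[of f 0] sum_norm_nonneg[of f 0] by linarith

lemma Lp_norm_le_Sp_norm:
  assumes "f \<in> Sp p \<Lambda> r"
  shows "Lp_norm p f \<le> Sp_norm p \<Lambda> r f"
proof (rule LIMSEQ_le_const)
  show "(\<lambda>n. Sp_norm p \<Lambda> r f + dev_norm f n) \<longlonglongrightarrow> Sp_norm p \<Lambda> r f"
    using assms tendsto_add[OF tendsto_const, of "dev_norm f" 0] by (simp add: Sp_iff)
  have "Lp_norm p f \<le> Sp_norm p \<Lambda> r f + dev_norm f n" for n
  proof -
    \<comment> \<open>Splits \<open>f\<close> into a partial sum, bounded by the supremum, and a
      deviation that tends to 0.\<close>
    have "Lp_norm p f = Lp_norm p (partial_sum n f - (partial_sum n f - f))"
      by simp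
    also have "\<dots> \<le> Lp_norm p (partial_sum n f) + Lp_norm p (partial_sum n f - f)"
      by (intro Lp_norm_diff[OF p] Lp_diff[OF p] partial_sum_Lp[OF p] Sp_Lp[OF assms])
    finally show ?thesis
      using partial_sum_le_sum_norm[of n f] sum_norm_le_Sp_norm[OF assms, of n]
        partial_sum_diff_le_dev_norm[OF Sp_Lp[OF assms], of n] by linarith
  qed
  then show "\<exists>N. \<forall>n\<ge>N. Lp_norm p f \<le> Sp_norm p \<Lambda> r f + dev_norm f n"
    by blast
qed

lemma Sp_zero: "0 \<in> Sp p \<Lambda> r"
proof -
  have "dev_norm 0 = (\<lambda>_. 0)"
    using dev_norm_scaleC[of 0 0] by (simp add: fun_eq_iff)
  then show ?thesis
    by (simp add: Sp_iff Lp_zero[OF p])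
qed

lemma Sp_add:
  assumes "f \<in> Sp p \<Lambda> r" "g \<in> Sp p \<Lambda> r"
  shows "f + g \<in> Sp p \<Lambda> r"
proof -
  have "dev_norm (f + g) \<longlonglongrightarrow> 0"
  proof (rule tendsto_sandwich[OF _ _ tendsto_const])
    show "(\<lambda>n. dev_norm f n + dev_norm g n) \<longlonglongrightarrow> 0"
      using assms tendsto_add[of "dev_norm f" 0 sequentially "dev_norm g" 0] by (simp add: Sp_iff)
  qed (use assms in \<open>simp_all add: dev_norm_nonneg dev_norm_add Sp_Lp\<close>)
  then show ?thesis
    using assms by (simp add: Sp_iff Lp_add[OF p])
qed

lemma Sp_scaleC: "f \<in> Sp p \<Lambda> r \<Longrightarrow> c *\<^sub>C f \<in> Sp p \<Lambda> r"
  using tendsto_mult_left[of "dev_norm f" 0 sequentially "cmod c"]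
  by (simp add: Sp_iff Lp_scaleC[OF p] dev_norm_scaleC[abs_def])

lemma Sp_subspace: "pfun.subspace (Sp p \<Lambda> r)"
  by (simp add: pfun.subspace_def Sp_zero Sp_add Sp_scaleC)

lemma Sp_norm_triangle:
  assumes "f \<in> Sp p \<Lambda> r" "g \<in> Sp p \<Lambda> r"
  shows "Sp_norm p \<Lambda> r (f + g) \<le> Sp_norm p \<Lambda> r f + Sp_norm p \<Lambda> r g"
  using sum_norm_add[OF Sp_Lp Sp_Lp, OF assms] sum_norm_le_Sp_norm[OF assms(1)] sum_norm_le_Sp_norm[OF assms(2)]
  by (intro Sp_norm_least) (meson add_mono order_trans)

lemma Sp_norm_scaleC:
  assumes "f \<in> Sp p \<Lambda> r"
  shows "Sp_norm p \<Lambda> r (c *\<^sub>C f) = cmod c * Sp_norm p \<Lambda> r f"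
proof -
  have le: "Sp_norm p \<Lambda> r (c *\<^sub>C f) \<le> cmod c * Sp_norm p \<Lambda> r f" if "f \<in> Sp p \<Lambda> r" for c f
    by (rule Sp_norm_least) (simp add: sum_norm_scaleC sum_norm_le_Sp_norm[OF that] mult_left_mono)
  show ?thesis
  proof (cases "c = 0")
    case True
    then show ?thesis
      using le[OF assms, of 0] Sp_norm_nonneg[OF Sp_zero] by simp
  next
    case False
    \<comment> \<open>The reverse inequality is the first one for the scalar
      \<open>inverse c\<close> and the function \<open>c *\<^sub>C f\<close>.\<close>
    then have "cmod c * Sp_norm p \<Lambda> r f \<le> Sp_norm p \<Lambda> r (c *\<^sub>C f)"
      using le[OF Sp_scaleC[OF assms], of "inverse c" c] unfolding norm_inverse by (simp add: field_simps)
    then show ?thesis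
      using le[OF assms] by (rule antisym[rotated])
  qed
qed

lemma Sp_norm_eq_zero_iff: "f \<in> Sp p \<Lambda> r \<Longrightarrow> Sp_norm p \<Lambda> r f = 0 \<longleftrightarrow> f = 0"
  using Lp_norm_eq_zero[OF p, of f] Lp_norm_le_Sp_norm[of f] Lp_norm_nonneg[OF p, of f]
    Sp_norm_scaleC[OF Sp_zero, of 0] by (auto simp: Sp_Lp)

text \<open>The limit is taken in L^p. Bounds on each mean survive the passage to this limit
  uniformly in the index of the mean, which gives both membership of the limit and convergence in
  the norm.\<close>

lemma Sp_complete:
  assumes \<sigma>: "\<And>n. \<sigma> n \<in> Sp p \<Lambda> r"
    and Cauchy: "\<And>e. 0 < e \<Longrightarrow> \<exists>M. \<forall>m\<ge>M. \<forall>n\<ge>M. Sp_norm p \<Lambda> r (\<sigma> m - \<sigma> n) < e"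
  obtains f where "f \<in> Sp p \<Lambda> r" "(\<lambda>n. Sp_norm p \<Lambda> r (\<sigma> n - f)) \<longlonglongrightarrow> 0"
proof -
  have \<sigma>_diff: "\<sigma> m - \<sigma> n \<in> Sp p \<Lambda> r" for m n
    by (rule pfun.subspace_diff[OF Sp_subspace \<sigma> \<sigma>])
  have Lp_Cauchy: "\<exists>N. \<forall>m\<ge>N. \<forall>n\<ge>N. Lp_norm p (\<sigma> m - \<sigma> n) < e" if "0 < e" for e
    using Cauchy[OF that] Lp_norm_le_Sp_norm[OF \<sigma>_diff] by (meson le_less_trans)
  obtain f where f: "f \<in> Lp p" "(\<lambda>n. Lp_norm p (\<sigma> n - f)) \<longlonglongrightarrow> 0"
    using Lp_space_complete[where \<sigma> = \<sigma>, OF p Sp_Lp[OF \<sigma>] Lp_Cauchy] .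
  note diff_Lp = Lp_diff[OF p Sp_Lp[OF \<sigma>] f(1)]
  \<comment> \<open>The bound is uniform in \<open>k\<close>: with \<open>m\<close> and
    \<open>k\<close> fixed, the other Cauchy index \<open>l\<close> tends to infinity, so the
    dependence of \<open>K\<close> on \<open>k\<close> does no harm.\<close>
  have close: "\<exists>M. \<forall>m\<ge>M. \<forall>k. sum_norm (\<sigma> m - f) k \<le> e" if "0 < e" for e
  proof -
    obtain M where M: "\<And>m n. M \<le> m \<Longrightarrow> M \<le> n \<Longrightarrow> Sp_norm p \<Lambda> r (\<sigma> m - \<sigma> n) < e"
      using Cauchy[OF \<open>0 < e\<close>] by blast
    have "sum_norm (\<sigma> m - f) k \<le> e" if m: "M \<le> m" for m k
    proof -
      obtain K where K: "\<And>g. g \<in> Lp p \<Longrightarrow> sum_norm g k \<le> K * Lp_norm p g"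
        using sum_norm_bounded[where n = k] by blast
      have "sum_norm (\<sigma> m - f) k \<le> e + K * Lp_norm p (\<sigma> l - f)" if l: "M \<le> l" for l
      proof -
        have "sum_norm (\<sigma> m - f) k = sum_norm ((\<sigma> m - \<sigma> l) + (\<sigma> l - f)) k"
          by simp
        also have "\<dots> \<le> sum_norm (\<sigma> m - \<sigma> l) k + sum_norm (\<sigma> l - f) k"
          by (rule sum_norm_add[OF Sp_Lp[OF \<sigma>_diff] diff_Lp])
        finally show ?thesis
          using sum_norm_le_Sp_norm[OF \<sigma>_diff, of m l k] M[OF m l] K[OF diff_Lp[of l]] by linarith
      qed
      moreover have "(\<lambda>l. e + K * Lp_norm p (\<sigma> l - f)) \<longlonglongrightarrow> e + K * 0"
        by (intro tendsto_intros f(2))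
      ultimately show ?thesis
        by (intro LIMSEQ_le_const[of "\<lambda>l. e + K * Lp_norm p (\<sigma> l - f)"]) auto
    qed
    then show ?thesis by blast
  qed
  have f_Sp: "f \<in> Sp p \<Lambda> r"
    unfolding Sp_iff
  proof (intro conjI f(1) LIMSEQ_I)
    fix e :: real assume "0 < e"
    define c where "c = 1 + real r"
    \<comment> \<open>Chosen so that \<open>dev_norm_le\<close> bounds the deviations of
      \<open>f - \<sigma> m\<close> by \<open>d + real r * d = e / 2\<close>.\<close>
    define d where "d = e / 2 / c"
    have "0 < c" by (simp add: c_def)
    then have "0 < d"
      using \<open>0 < e\<close> by (simp add: d_def)
    obtain M where M: "\<And>m k. M \<le> m \<Longrightarrow> sum_norm (\<sigma> m - f) k \<le> d"
      using close[OF \<open>0 < d\<close>] by blast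
    obtain M' where M': "\<And>m. M' \<le> m \<Longrightarrow> Lp_norm p (\<sigma> m - f) < d"
      using LIMSEQ_D[OF f(2) \<open>0 < d\<close>] by (auto simp: Lp_norm_nonneg[OF p])
    define m where "m = max M M'"
    have "sum_norm (f - \<sigma> m) k \<le> d" for k
      using M[of m k] sum_norm_scaleC[of "-1" "\<sigma> m - f" k] by (simp add: m_def)
    moreover have "Lp_norm p (f - \<sigma> m) \<le> d"
      using M'[of m] Lp_norm_minus_commute[OF p, of f "\<sigma> m"] by (simp add: m_def)
    moreover have diff: "f - \<sigma> m \<in> Lp p"
      by (rule Lp_diff[OF p f(1) Sp_Lp[OF \<sigma>]])
    ultimately have "dev_norm (f - \<sigma> m) k \<le> d + real r * d" for k
      using dev_norm_le[of "f - \<sigma> m" k] by (meson add_mono mult_left_mono of_nat_0_le_iff order_trans)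
    moreover have "d + real r * d = e / 2"
    proof -
      have "d + real r * d = c * d"
        by (simp add: c_def algebra_simps)
      also have "\<dots> = e / 2"
        using \<open>0 < c\<close> by (simp add: d_def)
      finally show ?thesis .
    qed
    \<comment> \<open>The remaining half of \<open>e\<close> is for the deviations of
      \<open>\<sigma> m\<close>, which tend to 0 because \<open>\<sigma> m\<close> lies in the
      space.\<close>
    moreover obtain N where N: "\<And>k. N \<le> k \<Longrightarrow> dev_norm (\<sigma> m) k < e / 2"
      using LIMSEQ_D[of "dev_norm (\<sigma> m)" 0 "e / 2"] \<sigma>[of m] \<open>0 < e\<close>
      by (auto simp: Sp_iff dev_norm_nonneg)
    ultimately have "dev_norm f k < e" if "N \<le> k" for k
      using dev_norm_add[OF diff Sp_Lp[OF \<sigma>], of m k] N[OF that] by (smt (verit) diff_add_cancel field_sum_of_halves)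
    then show "\<exists>N. \<forall>k\<ge>N. norm (dev_norm f k - 0) < e"
      by (auto simp: dev_norm_nonneg)
  qed
  show ?thesis
  proof (rule that[OF f_Sp], rule LIMSEQ_I)
    fix e :: real assume "0 < e"
    \<comment> \<open>The supremum inherits only a non-strict bound, hence \<open>e / 2\<close> in
      place of \<open>e\<close>.\<close>
    then obtain M where "\<And>m k. M \<le> m \<Longrightarrow> sum_norm (\<sigma> m - f) k \<le> e / 2"
      using close[of "e / 2"] by auto
    then have "Sp_norm p \<Lambda> r (\<sigma> m - f) < e" if "M \<le> m" for m
      using Sp_norm_least[of "\<sigma> m - f" "e / 2"] that \<open>0 < e\<close> by fastforce
    moreover have "0 \<le> Sp_norm p \<Lambda> r (\<sigma> m - f)" for m
      by (rule Sp_norm_nonneg[OF pfun.subspace_diff[OF Sp_subspace \<sigma> f_Sp]])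
    ultimately show "\<exists>M. \<forall>m\<ge>M. norm (Sp_norm p \<Lambda> r (\<sigma> m - f) - 0) < e"
      by auto
  qed
qed

end

theorem theorem9:
  fixes \<Lambda> :: "nat \<Rightarrow> real" and r :: nat and p :: real
  assumes "incseq \<Lambda>" and "\<And>k. 0 < \<Lambda> k" and "filterlim \<Lambda> at_top sequentially"
    and "2 \<le> r" and "1 \<le> p"
  shows "(\<forall>f\<in>Sp p \<Lambda> r. bdd_above (range (\<lambda>n. Lp_norm p (sum_mean \<Lambda> r f n)))) \<and>
         complex_banach_space_on (*\<^sub>C) (Sp p \<Lambda> r) (Sp_norm p \<Lambda> r)"
proof -
  interpret strong_means \<Lambda> r p
    by unfold_locales (use assms in auto)
  have "\<exists>f\<in>Sp p \<Lambda> r. (\<lambda>n. Sp_norm p \<Lambda> r (\<sigma> n - f)) \<longlonglongrightarrow> 0"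
    if "range \<sigma> \<subseteq> Sp p \<Lambda> r"
      and "\<forall>e>0. \<exists>M. \<forall>m\<ge>M. \<forall>n\<ge>M. Sp_norm p \<Lambda> r (\<sigma> m - \<sigma> n) < e" for \<sigma>
  proof -
    have "\<sigma> n \<in> Sp p \<Lambda> r" for n
      using that(1) by auto
    then show ?thesis
      using Sp_complete[of \<sigma>] that(2) by metis
  qed
  then show ?thesis
    unfolding complex_banach_space_on_def
    using bdd_above_sum_norm vector_space_scaleC Sp_subspace Sp_norm_nonneg Sp_norm_eq_zero_iff
      Sp_norm_triangle Sp_norm_scaleC
    by (simp add: sum_norm_def[abs_def])
qed

end
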